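(* Let $A$ be a $d\times d$ positive semidefinite matrix, $\ell\in[d]$, $\epsilon>0$, $\delta>0$. Let $\tilde\phi_1,\dots,\tilde\phi_\ell$ be the output of the following procedure PCA$(A,\ell,\epsilon,\delta)$: set $A_0=A$; for $i=1,\dots,\ell$, let $\tilde\phi_i=\mathrm{PowerMethod}(A_{i-1},\epsilon/(2\ell),\delta/(2\ell))$ and $A_i=(I-\tilde\phi_i\tilde\phi_i^\top)A_{i-1}(I-\tilde\phi_i\tilde\phi_i^\top)$. Here $\mathrm{PowerMethod}(B,\epsilon',\delta')$ draws $g\sim\mathcal{N}(0,I_d)$ and returns $B^tg/\|B^tg\|$ with $t=L\cdot\frac{\log d+\log(1/\delta')+\log(1/\epsilon')}{\epsilon'}$ for a sufficiently large absolute constant $L$. Define $$\tilde A=\sum_{i=1}^{\ell}\langle\tilde\phi_i,A\tilde\phi_i\rangle\tilde\phi_i\tilde\phi_i^\top+\Big(I-\sum_{i=1}^\ell\tilde\phi_i\tilde\phi_i^\top\Big)A\Big(I-\sum_{i=1}^\ell\tilde\phi_i\tilde\phi_i^\top\Big).$$ Then with probability at least $1-O(\ell\delta)$, $(1-\epsilon)^{\ell}\tilde A\preceq A\preceq(1+\epsilon)^{\ell}\tilde A$.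
   Formalization: The formal theorem assumes ε ≤ 1 in addition to ε > 0; for larger ε the claim fails, e.g. d = ℓ = 2, A = I, ε = 3 and small δ, where Ã = I almost surely and (1-ε)^2 Ã = 4I is not ⪯ I. *)

theory Defs
  imports "HOL-Probability.Probability" "Jordan_Normal_Form.Matrix"
begin

text \<open>
  Matrices and vectors are those of \<open>Jordan_Normal_Form\<close>: the dimension is a natural number, so
  that absolute constants can be quantified before it.
\<close>

definition positive_semidefinite :: "real mat \<Rightarrow> bool" where
  "positive_semidefinite A \<longleftrightarrow>
     square_mat A \<and> transpose_mat A = A \<and>
     (\<forall>v \<in> carrier_vec (dim_row A). v \<bullet> (A *\<^sub>v v) \<ge> 0)"

definition loewner_le :: "real mat \<Rightarrow> real mat \<Rightarrow> bool" (infix \<open>\<preceq>\<^sub>L\<close> 50) where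
  "A \<preceq>\<^sub>L B \<longleftrightarrow>
     dim_row A = dim_row B \<and> dim_col A = dim_col B \<and> positive_semidefinite (B - A)"

definition vec_norm2 :: "real vec \<Rightarrow> real" where
  "vec_norm2 v = sqrt (v \<bullet> v)"

definition outer_square :: "real vec \<Rightarrow> real mat" where
  "outer_square v = mat (dim_vec v) (dim_vec v) (\<lambda>(j, k). v $ j * v $ k)"

definition mat_sum :: "nat \<Rightarrow> ('i \<Rightarrow> real mat) \<Rightarrow> 'i set \<Rightarrow> real mat" where
  "mat_sum d M I = mat d d (\<lambda>(j, k). \<Sum>i\<in>I. M i $$ (j, k))"

text \<open>The real number of iterations is rounded up to a natural number.\<close>

definition power_method_iters :: "real \<Rightarrow> nat \<Rightarrow> real \<Rightarrow> real \<Rightarrow> nat" where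
  "power_method_iters L d \<epsilon> \<delta> = nat \<lceil>L * ((ln (real d) + ln (1 / \<delta>) + ln (1 / \<epsilon>)) / \<epsilon>)\<rceil>"

text \<open>
  The randomized procedures are written as deterministic functions of their Gaussian draws.
  If \<open>B\<^sup>t g = 0\<close> (which has positive probability only if \<open>B\<^sup>t = 0\<close>), the quotient
  \<open>B\<^sup>t g / \<parallel>B\<^sup>t g\<parallel>\<close> is the zero vector, since \<open>1 / 0 = 0\<close>.
\<close>

definition power_method :: "real \<Rightarrow> real mat \<Rightarrow> real \<Rightarrow> real \<Rightarrow> real vec \<Rightarrow> real vec" where
  "power_method L B \<epsilon> \<delta> g =
     (let x = (B ^\<^sub>m power_method_iters L (dim_row B) \<epsilon> \<delta>) *\<^sub>v g
      in (1 / vec_norm2 x) \<cdot>\<^sub>v x)"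

text \<open>
  Here \<open>pca_mat L A l \<epsilon> \<delta> g i\<close> is the deflated matrix \<open>A\<^sub>i\<close>. Indices are shifted by one for the
  vectors: \<open>pca_vec L A l \<epsilon> \<delta> g i\<close>, for \<open>i < l\<close>, is the output number \<open>i + 1\<close>, computed from
  \<open>A\<^sub>i\<close> with the fresh Gaussian vector \<open>g i\<close>.
\<close>

primrec pca_mat ::
  "real \<Rightarrow> real mat \<Rightarrow> nat \<Rightarrow> real \<Rightarrow> real \<Rightarrow> (nat \<Rightarrow> real vec) \<Rightarrow> nat \<Rightarrow> real mat" where
  "pca_mat L A l \<epsilon> \<delta> g 0 = A"
| "pca_mat L A l \<epsilon> \<delta> g (Suc i) =
     (let B = pca_mat L A l \<epsilon> \<delta> g i;
          \<phi> = power_method L B (\<epsilon> / (2 * real l)) (\<delta> / (2 * real l)) (g i);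
          P = 1\<^sub>m (dim_row A) - outer_square \<phi>
      in P * B * P)"

definition pca_vec ::
  "real \<Rightarrow> real mat \<Rightarrow> nat \<Rightarrow> real \<Rightarrow> real \<Rightarrow> (nat \<Rightarrow> real vec) \<Rightarrow> nat \<Rightarrow> real vec" where
  "pca_vec L A l \<epsilon> \<delta> g i =
     power_method L (pca_mat L A l \<epsilon> \<delta> g i) (\<epsilon> / (2 * real l)) (\<delta> / (2 * real l)) (g i)"

definition pca_approx :: "real mat \<Rightarrow> nat \<Rightarrow> (nat \<Rightarrow> real vec) \<Rightarrow> real mat" where
  "pca_approx A l \<phi> =
     (let d = dim_row A;
          R = 1\<^sub>m d - mat_sum d (\<lambda>i. outer_square (\<phi> i)) {..<l}
      in mat_sum d (\<lambda>i. (\<phi> i \<bullet> (A *\<^sub>v \<phi> i)) \<cdot>\<^sub>m outer_square (\<phi> i)) {..<l} + R * A * R)"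

text \<open>
  The joint law of the coordinates of \<open>l\<close> independent standard Gaussian vectors in dimension \<open>d\<close>:
  \<open>\<omega> (i, j)\<close> is coordinate \<open>j\<close> of the vector number \<open>i\<close>.
\<close>

definition gaussian_draws :: "nat \<Rightarrow> nat \<Rightarrow> (nat \<times> nat \<Rightarrow> real) measure" where
  "gaussian_draws l d = (\<Pi>\<^sub>M ij \<in> {..<l} \<times> {..<d}. density lborel (\<lambda>x. ennreal (std_normal_density x)))"

definition draw_vec :: "nat \<Rightarrow> (nat \<times> nat \<Rightarrow> real) \<Rightarrow> nat \<Rightarrow> real vec" where
  "draw_vec d \<omega> i = vec d (\<lambda>j. \<omega> (i, j))"

end

theory Submission
  imports Defs "HOL-Real_Asymp.Real_Asymp"
begin

text \<open>
  For a positive semidefinite \<open>B\<close> and a vector \<open>g\<close>, put \<open>m\<^sub>k = \<langle>g, B\<^sup>k g\<rangle>\<close>.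
  A vector \<open>x = B\<^sup>t g\<close> splits \<open>B\<close> into two blocks up to a relative error as soon as
  \<open>\<langle>y, B x\<rangle>\<^sup>2\<close> is small compared with \<open>\<langle>x, B x\<rangle> \<langle>y, B y\<rangle>\<close> for all \<open>y \<bottom> x\<close>. By the
  Cauchy-Schwarz inequality for \<open>B\<close>, applied to \<open>y\<close> and \<open>(\<mu> - B) B\<^bsup>t-1\<^esup> g\<close>, this holds if
  \<open>\<mu>\<^sup>2 m\<^sub>n - 2 \<mu> m\<^sub>n\<^sub>+\<^sub>1 + m\<^sub>n\<^sub>+\<^sub>2\<close> is small compared with \<open>m\<^sub>n\<^sub>+\<^sub>2\<close>, where
  \<open>n = 2 t - 1\<close>. No spectral theorem is needed: the sequence
  \<open>M\<^sub>k = \<mu> m\<^sub>k - (1 - e) m\<^sub>k\<^sub>+\<^sub>1\<close> is log-convex if \<open>B \<preceq> \<mu> I\<close>, so its ratios are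
  nondecreasing, and the bound can only fail by a term that decays geometrically in \<open>n\<close>. As \<open>\<mu>\<close>
  one takes \<open>\<mu>\<^sup>k = d c\<close>, where \<open>c\<close> is the largest diagonal entry of \<open>B\<^sup>k\<close> and \<open>k = 2 t + 1\<close>;
  then \<open>m\<^sub>k\<close> is bounded below through a single coordinate of \<open>B\<^sup>k g\<close>, which is small only
  with small probability. No gap between eigenvalues enters.

  The outputs of the deflation are orthogonal, hence \<open>A\<^sub>i = R\<^sub>i A R\<^sub>i\<close> with
  \<open>R\<^sub>i = I - \<Sum>\<^sub>j\<^sub><\<^sub>i \<phi>\<^sub>j \<phi>\<^sub>j\<^sup>T\<close>, and the errors of the steps multiply.
\<close>

unbundle no inner_syntax
unbundle no vec_syntax

section \<open>Log-convex sequences and moments of positive semidefinite matrices\<close>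

lemma discriminant_le:
  fixes a b c :: real
  assumes nonneg: "\<And>s. 0 \<le> a + 2 * s * b + s\<^sup>2 * c" and "0 \<le> c"
  shows "b\<^sup>2 \<le> a * c"
proof (cases "c = 0")
  case True
  \<comment> \<open>With \<open>c = 0\<close> the polynomial is affine in \<open>s\<close>; a
    nonzero slope is refuted at the point where its value is -1.\<close>
  have "b = 0"
  proof (rule ccontr)
    assume "b \<noteq> 0"
    then show False
      using nonneg[of "- (a + 1) / (2 * b)"] True by (simp add: field_simps)
  qed
  then show ?thesis using True by simp
next
  case False
  then have "0 < c" using assms(2) by simp
  then show ?thesis
    \<comment> \<open>The minimiser of the quadratic.\<close>
    using nonneg[of "- b / c"] by (simp add: field_simps power2_eq_square)
qed

text \<open>Log-convexity makes the ratios \<open>a (Suc i) / a i\<close> nondecreasing, so a first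
  ratio above \<open>r\<close> persists. The form without division fits because positivity of the
  terms is only established along the induction.\<close>

lemma logconvex_growth:
  fixes a :: "nat \<Rightarrow> real"
  assumes logconvex: "\<And>i. (a (Suc i))\<^sup>2 \<le> a i * a (Suc (Suc i))"
    and "0 \<le> r" "0 < a 0" "r * a 0 < a 1"
  shows "r * a i < a (Suc i)"
proof -
  have "0 < a i \<and> r * a i < a (Suc i)"
  proof (induction i)
    case 0
    then show ?case using assms by simp
  next
    case (Suc i)
    have pos: "0 < a (Suc i)"
      using Suc assms(2) by (meson less_imp_le mult_nonneg_nonneg order_le_less_trans)
    have "a i * (r * a (Suc i)) = (r * a i) * a (Suc i)" by simp
    also have "\<dots> < a (Suc i) * a (Suc i)"
      using Suc pos by (intro mult_strict_right_mono) auto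
    also have "\<dots> \<le> a i * a (Suc (Suc i))"
      using logconvex[of i] by (simp add: power2_eq_square)
    finally show ?case using Suc pos by simp
  qed
  then show ?thesis by simp
qed

text \<open>The product of the first \<open>k\<close> ratios telescopes, and each of them exceeds
  \<open>r\<close>.\<close>

lemma logconvex_power_less:
  fixes a :: "nat \<Rightarrow> real"
  assumes logconvex: "\<And>i. (a (Suc i))\<^sup>2 \<le> a i * a (Suc (Suc i))"
    and "0 \<le> r" "0 < a 0" "r * a 0 < a 1" "0 < k"
  shows "r ^ k * a 0 < a k"
proof -
  note growth = logconvex_growth[OF assms(1-4)]
  have "r ^ Suc i * a 0 < a (Suc i)" for i
  proof (induction i)
    case 0
    then show ?case using assms by simp
  next
    case (Suc i)
    have "r ^ Suc (Suc i) * a 0 = r * (r ^ Suc i * a 0)" by simp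
    also have "\<dots> \<le> r * a (Suc i)"
      using Suc \<open>0 \<le> r\<close> by (intro mult_left_mono) auto
    also have "\<dots> < a (Suc (Suc i))" by (rule growth)
    finally show ?case .
  qed
  then show ?thesis using \<open>0 < k\<close> by (cases k) auto
qed

text \<open>The converse use of monotone ratios: a ratio below \<open>r\<close> at \<open>n\<close>
  bounds all earlier ratios by \<open>r\<close>, and their product controls
  \<open>a n\<close>.\<close>

lemma logconvex_decay:
  fixes a :: "nat \<Rightarrow> real"
  assumes nonneg: "\<And>i. 0 \<le> a i"
    and logconvex: "\<And>i. (a (Suc i))\<^sup>2 \<le> a i * a (Suc (Suc i))"
    and "0 \<le> r" "a (Suc n) < r * a n"
  shows "a n \<le> r ^ n * a 0"
proof -
  \<comment> \<open>Downward induction from \<open>n\<close>. Positivity is carried along because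
    each step cancels a term of the sequence.\<close>
  have "i \<le> n \<Longrightarrow> a (Suc (n - i)) \<le> r * a (n - i) \<and> 0 < a (n - i)" for i
  proof (induction i)
    case 0
    have "0 < r * a n" using assms(1)[of "Suc n"] assms(4) by linarith
    then have "a n \<noteq> 0" by auto
    then show ?case using assms(4) nonneg[of n] by simp
  next
    case (Suc i)
    define m where "m = n - Suc i"
    have m: "n - i = Suc m" using Suc.prems by (simp add: m_def)
    have IH: "a (Suc (Suc m)) \<le> r * a (Suc m)" "0 < a (Suc m)" using Suc m by simp_all
    have lc: "a (Suc m) * a (Suc m) \<le> a m * a (Suc (Suc m))"
      using logconvex[of m] by (simp add: power2_eq_square)
    have "0 < a (Suc m) * a (Suc m)" using IH(2) by simp
    then have "a m \<noteq> 0" using lc by auto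
    then have pos: "0 < a m" using nonneg[of m] by simp
    have "a (Suc m) * a (Suc m) \<le> a m * (r * a (Suc m))"
      using lc mult_left_mono[OF IH(1), of "a m"] pos by linarith
    then have "a (Suc m) * a (Suc m) \<le> (r * a m) * a (Suc m)" by (simp add: ac_simps)
    then have "a (Suc m) \<le> r * a m" using IH(2) by (rule mult_right_le_imp_le)
    then show ?case using pos by (simp add: m_def)
  qed
  then have step: "a (Suc i) \<le> r * a i" if "i \<le> n" for i
    using that by (metis diff_diff_cancel diff_le_self)
  have "i \<le> n \<Longrightarrow> a i \<le> r ^ i * a 0" for i
  proof (induction i)
    case (Suc i)
    have "a (Suc i) \<le> r * a i" using step Suc by simp
    also have "\<dots> \<le> r * (r ^ i * a 0)" using Suc \<open>0 \<le> r\<close> by (intro mult_left_mono) auto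
    finally show ?case by (simp add: ac_simps)
  qed simp
  then show ?thesis by simp
qed

lemma self_scalar_prod_nonneg: "0 \<le> (x :: real vec) \<bullet> x"
  unfolding scalar_prod_def by (intro sum_nonneg) simp

section \<open>Quadratic form and moments of a positive semidefinite matrix\<close>

locale psd_mat =
  fixes B :: "real mat" and d :: nat
  assumes carrier: "B \<in> carrier_mat d d"
    and psd: "positive_semidefinite B"
begin

lemma mult_carrier[simp]: "x \<in> carrier_vec d \<Longrightarrow> B *\<^sub>v x \<in> carrier_vec d"
  using carrier by (rule mult_mat_vec_carrier)

lemma pow_mult_carrier[simp]: "x \<in> carrier_vec d \<Longrightarrow> (B ^\<^sub>m k) *\<^sub>v x \<in> carrier_vec d"
  using pow_carrier_mat[OF carrier] by (rule mult_mat_vec_carrier)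

lemma form_nonneg: "x \<in> carrier_vec d \<Longrightarrow> 0 \<le> x \<bullet> (B *\<^sub>v x)"
  using psd carrier unfolding positive_semidefinite_def by auto

lemma self_adjoint:
  assumes "x \<in> carrier_vec d" "y \<in> carrier_vec d"
  shows "(B *\<^sub>v x) \<bullet> y = x \<bullet> (B *\<^sub>v y)"
  using transpose_vec_mult_scalar[OF carrier assms(2,1)] psd
  unfolding positive_semidefinite_def by simp

lemma form_sym:
  assumes "x \<in> carrier_vec d" "y \<in> carrier_vec d"
  shows "x \<bullet> (B *\<^sub>v y) = y \<bullet> (B *\<^sub>v x)"
  using self_adjoint[OF assms] comm_scalar_prod[of "B *\<^sub>v x" d y] assms by simp

lemma form_add_smult:
  assumes x: "x \<in> carrier_vec d" and y: "y \<in> carrier_vec d"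
  shows "(x + s \<cdot>\<^sub>v y) \<bullet> (B *\<^sub>v (x + s \<cdot>\<^sub>v y)) =
    x \<bullet> (B *\<^sub>v x) + 2 * s * (x \<bullet> (B *\<^sub>v y)) + s\<^sup>2 * (y \<bullet> (B *\<^sub>v y))"
proof -
  have "B *\<^sub>v (x + s \<cdot>\<^sub>v y) = B *\<^sub>v x + s \<cdot>\<^sub>v (B *\<^sub>v y)"
    using x y carrier by (simp add: mult_add_distrib_mat_vec mult_mat_vec)
  then show ?thesis
    using x y form_sym[OF y x]
    by (simp add: add_scalar_prod_distrib[of _ d] scalar_prod_add_distrib[of _ d]
        power2_eq_square algebra_simps)
qed

text \<open>The form of \<open>B\<close> along the line \<open>x + s y\<close> is a nonnegative
  quadratic in \<open>s\<close>; its discriminant gives the inequality.\<close>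

lemma form_cauchy_schwarz:
  assumes x: "x \<in> carrier_vec d" and y: "y \<in> carrier_vec d"
  shows "(x \<bullet> (B *\<^sub>v y))\<^sup>2 \<le> (x \<bullet> (B *\<^sub>v x)) * (y \<bullet> (B *\<^sub>v y))"
proof (rule discriminant_le)
  fix s
  show "0 \<le> x \<bullet> (B *\<^sub>v x) + 2 * s * (x \<bullet> (B *\<^sub>v y)) + s\<^sup>2 * (y \<bullet> (B *\<^sub>v y))"
    using form_nonneg[of "x + s \<cdot>\<^sub>v y"] x y by (simp add: form_add_smult)
qed (simp add: form_nonneg y)

lemma pow_Suc_mult:
  "x \<in> carrier_vec d \<Longrightarrow> (B ^\<^sub>m Suc k) *\<^sub>v x = (B ^\<^sub>m k) *\<^sub>v (B *\<^sub>v x)"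
  using assoc_mult_mat_vec[OF pow_carrier_mat[OF carrier] carrier] by simp

lemma pow_0_mult: "x \<in> carrier_vec d \<Longrightarrow> (B ^\<^sub>m 0) *\<^sub>v x = x"
  using carrier by auto

lemma mult_pow_commute:
  "x \<in> carrier_vec d \<Longrightarrow> B *\<^sub>v ((B ^\<^sub>m k) *\<^sub>v x) = (B ^\<^sub>m k) *\<^sub>v (B *\<^sub>v x)"
proof (induction k arbitrary: x)
  case 0
  then show ?case using pow_0_mult by (metis mult_carrier)
next
  case (Suc k)
  then show ?case by (simp only: pow_Suc_mult mult_carrier)
qed

lemma pow_add_mult:
  "x \<in> carrier_vec d \<Longrightarrow> (B ^\<^sub>m (i + j)) *\<^sub>v x = (B ^\<^sub>m i) *\<^sub>v ((B ^\<^sub>m j) *\<^sub>v x)"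
proof (induction j arbitrary: x)
  case 0
  then show ?case using pow_0_mult by simp
next
  case (Suc j)
  then show ?case by (simp only: pow_Suc_mult mult_carrier add_Suc_right)
qed

lemma pow_self_adjoint:
  assumes "x \<in> carrier_vec d" "y \<in> carrier_vec d"
  shows "((B ^\<^sub>m k) *\<^sub>v x) \<bullet> y = x \<bullet> ((B ^\<^sub>m k) *\<^sub>v y)"
  using assms
proof (induction k arbitrary: x y)
  case 0
  then show ?case using pow_0_mult by simp
next
  case (Suc k)
  then show ?case
    by (simp only: pow_Suc_mult mult_carrier self_adjoint pow_mult_carrier mult_pow_commute)
qed

definition moment :: "real vec \<Rightarrow> nat \<Rightarrow> real" where
  "moment x k = x \<bullet> ((B ^\<^sub>m k) *\<^sub>v x)"

lemma moment_0: "x \<in> carrier_vec d \<Longrightarrow> moment x 0 = x \<bullet> x"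
  by (simp only: moment_def pow_0_mult)

lemma moment_1: "x \<in> carrier_vec d \<Longrightarrow> moment x (Suc 0) = x \<bullet> (B *\<^sub>v x)"
  by (simp only: moment_def pow_0_mult pow_Suc_mult mult_carrier)

lemma moment_pow:
  assumes "x \<in> carrier_vec d"
  shows "((B ^\<^sub>m i) *\<^sub>v x) \<bullet> ((B ^\<^sub>m j) *\<^sub>v x) = moment x (i + j)"
  unfolding moment_def using assms by (simp only: pow_self_adjoint pow_mult_carrier pow_add_mult)

text \<open>Replacing \<open>x\<close> by \<open>(B ^\<^sub>m i) *\<^sub>v x\<close> shifts the
  order by \<open>2 * i\<close>. Hence a statement about the moments of all vectors need only be
  checked at the orders 0 and 1, one for each parity.\<close>

lemma moment_pow_shift:
  assumes "x \<in> carrier_vec d"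
  shows "moment ((B ^\<^sub>m i) *\<^sub>v x) k = moment x (2 * i + k)"
proof -
  have "(B ^\<^sub>m k) *\<^sub>v ((B ^\<^sub>m i) *\<^sub>v x) = (B ^\<^sub>m (i + k)) *\<^sub>v x"
    using pow_add_mult[OF assms, of k i] by (simp add: add.commute)
  then show ?thesis using moment_pow[OF assms, of i "i + k"] by (simp add: moment_def mult_2 add.assoc)
qed

lemma moment_2: "x \<in> carrier_vec d \<Longrightarrow> moment x 2 = (B *\<^sub>v x) \<bullet> (B *\<^sub>v x)"
  using moment_pow[of x 1 1] carrier by (simp add: numeral_2_eq_2)

lemma moment_nonneg:
  assumes x: "x \<in> carrier_vec d"
  shows "0 \<le> moment x k"
proof -
  obtain i j where k: "k = 2 * i + j" and j: "j = 0 \<or> j = Suc 0"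
    by (rule that[of "k div 2" "k mod 2"]) auto
  show ?thesis
    unfolding k moment_pow_shift[OF x, symmetric]
    using j x by (auto simp: moment_0 moment_1 form_nonneg self_scalar_prod_nonneg)
qed

lemma moment_add_smult:
  assumes x: "x \<in> carrier_vec d"
  shows "moment (x + s \<cdot>\<^sub>v (B *\<^sub>v x)) k =
    moment x k + 2 * s * moment x (Suc k) + s\<^sup>2 * moment x (Suc (Suc k))"
proof -
  have Bx: "B *\<^sub>v x \<in> carrier_vec d" using x by simp
  have *: "(B ^\<^sub>m k) *\<^sub>v (x + s \<cdot>\<^sub>v (B *\<^sub>v x)) = (B ^\<^sub>m k) *\<^sub>v x + s \<cdot>\<^sub>v ((B ^\<^sub>m Suc k) *\<^sub>v x)"
    using x Bx pow_carrier_mat[OF carrier, of k]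
    by (simp only: mult_add_distrib_mat_vec[of _ d d] mult_mat_vec[of _ d d] smult_carrier_vec pow_Suc_mult)
  have B1: "(B *\<^sub>v x) \<bullet> ((B ^\<^sub>m i) *\<^sub>v x) = moment x (Suc i)" for i
    using moment_pow[OF x, of 1 i] carrier by simp
  have B0: "x \<bullet> ((B ^\<^sub>m i) *\<^sub>v x) = moment x i" for i
    by (simp add: moment_def)
  show ?thesis
    unfolding moment_def[of "x + s \<cdot>\<^sub>v (B *\<^sub>v x)"] *
    using x Bx pow_mult_carrier[OF x, of k] pow_mult_carrier[OF x, of "Suc k"]
    by (simp add: add_scalar_prod_distrib[of _ d] scalar_prod_add_distrib[of _ d] B0 B1
        power2_eq_square algebra_simps del: pow_mat.simps)
qed

text \<open>\<open>M k\<close> is the form of \<open>(a I - b B) B ^ k\<close> at \<open>x\<close>.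
  The two hypotheses say that this form is nonnegative for \<open>k = 0\<close> and
  \<open>k = 1\<close>; the parity shift extends this to all \<open>k\<close>, and evaluating it at
  \<open>h + s B h\<close> gives a nonnegative quadratic in \<open>s\<close>, whose discriminant is
  log-convexity.\<close>

lemma
  assumes 0: "\<And>x. x \<in> carrier_vec d \<Longrightarrow> b * moment x 1 \<le> a * moment x 0"
    and 1: "\<And>x. x \<in> carrier_vec d \<Longrightarrow> b * moment x 2 \<le> a * moment x 1"
    and x: "x \<in> carrier_vec d"
  defines "M \<equiv> \<lambda>k. a * moment x k - b * moment x (Suc k)"
  shows shifted_moment_nonneg: "0 \<le> M k"
    and shifted_moment_logconvex: "(M (Suc k))\<^sup>2 \<le> M k * M (Suc (Suc k))"
proof -
  have ge: "b * moment y (Suc j) \<le> a * moment y j" if "y \<in> carrier_vec d" "j = 0 \<or> j = 1" for y j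
    using 0[OF that(1)] 1[OF that(1)] that(2) by (auto simp: numeral_2_eq_2)
  have M_nonneg: "0 \<le> M k" for k
  proof -
    obtain i j where k: "k = 2 * i + j" and j: "j = 0 \<or> j = 1"
      by (rule that[of "k div 2" "k mod 2"]) auto
    show ?thesis
      using ge[OF pow_mult_carrier[OF x, of i] j] by (simp add: M_def k moment_pow_shift x)
  qed
  then show "0 \<le> M k" .
  obtain i j where k: "k = 2 * i + j" and j: "j = 0 \<or> j = 1"
    by (rule that[of "k div 2" "k mod 2"]) auto
  show "(M (Suc k))\<^sup>2 \<le> M k * M (Suc (Suc k))"
  proof (rule discriminant_le[OF _ M_nonneg])
    fix s
    define h where "h = (B ^\<^sub>m i) *\<^sub>v x"
    have h: "h \<in> carrier_vec d" using x by (simp add: h_def)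
    have mh: "moment h r = moment x (2 * i + r)" for r
      unfolding h_def by (rule moment_pow_shift[OF x])
    \<comment> \<open>Expanded in \<open>s\<close>, this difference has the coefficients
      \<open>M k\<close>, \<open>2 * M (Suc k)\<close> and \<open>M (Suc (Suc k))\<close>.\<close>
    have "b * moment (h + s \<cdot>\<^sub>v (B *\<^sub>v h)) (Suc j) \<le> a * moment (h + s \<cdot>\<^sub>v (B *\<^sub>v h)) j"
      using h j by (intro ge) auto
    then show "0 \<le> M k + 2 * s * M (Suc k) + s\<^sup>2 * M (Suc (Suc k))"
      unfolding moment_add_smult[OF h] mh M_def k by (simp add: algebra_simps)
  qed
qed

lemma moment_logconvex:
  assumes "x \<in> carrier_vec d"
  shows "(moment x (Suc k))\<^sup>2 \<le> moment x k * moment x (Suc (Suc k))"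
proof -
  have "0 * moment y 1 \<le> 1 * moment y 0" "0 * moment y 2 \<le> 1 * moment y 1"
    if "y \<in> carrier_vec d" for y
    using moment_nonneg[OF that] by simp_all
  from shifted_moment_logconvex[OF this assms] show ?thesis by simp
qed

text \<open>Stands in for the fact that the top eigenvalue of \<open>B ^\<^sub>m k\<close> is the
  k-th power of that of \<open>B\<close>: if the first ratio of moments exceeded
  \<open>\<mu>\<close>, growth would push \<open>moment x k\<close> strictly above
  \<open>\<mu> ^ k * moment x 0\<close>.\<close>

lemma form_le_of_moment_le:
  assumes \<mu>: "0 \<le> \<mu>" and k: "0 < k"
    and le: "moment x k \<le> \<mu> ^ k * (x \<bullet> x)"
    and x: "x \<in> carrier_vec d"
  shows "x \<bullet> (B *\<^sub>v x) \<le> \<mu> * (x \<bullet> x)"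
proof (rule ccontr)
  assume "\<not> ?thesis"
  then have *: "\<mu> * moment x 0 < moment x 1" using x by (simp add: moment_0 moment_1)
  \<comment> \<open>The growth lemma needs a positive start; if it vanished, log-convexity would
    make the first moment vanish as well.\<close>
  have "moment x 0 \<noteq> 0"
  proof
    assume "moment x 0 = 0"
    then have "(moment x 1)\<^sup>2 \<le> 0" using moment_logconvex[OF x, of 0] by simp
    then have "moment x 1 = 0" by simp
    with * \<open>moment x 0 = 0\<close> show False by simp
  qed
  then have "0 < moment x 0" using moment_nonneg[OF x, of 0] by simp
  from logconvex_power_less[of "moment x", OF moment_logconvex[OF x] \<mu> this * k]
  show False using le x by (simp add: moment_0)
qed

text \<open>Passes from \<open>B\<close> bounded by \<open>\<mu> I\<close> to
  \<open>B\<^sup>2\<close> bounded by \<open>\<mu> B\<close> without a square root of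
  \<open>B\<close>: the bound at \<open>B x\<close> compares the third moment with the second, and
  log-convexity carries this ratio bound down one order.\<close>

lemma moment_2_le:
  assumes le: "\<And>y. y \<in> carrier_vec d \<Longrightarrow> y \<bullet> (B *\<^sub>v y) \<le> \<mu> * (y \<bullet> y)"
    and x: "x \<in> carrier_vec d"
  shows "moment x 2 \<le> \<mu> * moment x 1"
proof (cases "moment x 2 = 0")
  case True
  have "0 \<le> \<mu> \<or> moment x 1 = 0"
  proof -
    have "0 \<le> \<mu> * moment x 0" "0 \<le> moment x 0"
      using le[OF x] form_nonneg[OF x] x moment_nonneg[OF x, of 0] by (simp_all add: moment_0)
    moreover have "(moment x 1)\<^sup>2 \<le> moment x 0 * moment x 2"
      using moment_logconvex[OF x, of 0] by (simp add: numeral_2_eq_2)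
    ultimately show ?thesis using True by (auto simp: zero_le_mult_iff)
  qed
  then show ?thesis using True moment_nonneg[OF x, of 1] by auto
next
  case False
  then have pos: "0 < moment x 2" using moment_nonneg[OF x, of 2] by simp
  have "moment x 3 = (B *\<^sub>v x) \<bullet> (B *\<^sub>v (B *\<^sub>v x))"
    using moment_pow_shift[OF x, of 1 1] moment_1[of "B *\<^sub>v x"] x carrier by (simp add: numeral_3_eq_3)
  then have 3: "moment x 3 \<le> \<mu> * moment x 2" using le[of "B *\<^sub>v x"] x by (simp add: moment_2)
  have "moment x 2 * moment x 2 \<le> moment x 1 * moment x 3"
    using moment_logconvex[OF x, of 1] by (simp add: power2_eq_square numeral_2_eq_2 numeral_3_eq_3)
  also have "\<dots> \<le> moment x 1 * (\<mu> * moment x 2)"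
    using 3 moment_nonneg[OF x] by (intro mult_left_mono)
  finally have "moment x 2 * moment x 2 \<le> (\<mu> * moment x 1) * moment x 2" by (simp add: ac_simps)
  then show ?thesis using pos by (rule mult_right_le_imp_le)
qed

end

section \<open>One step of the power method\<close>

lemma mult_unit_vec_index:
  fixes C :: "'a :: semiring_1 mat"
  assumes "C \<in> carrier_mat m n" "i < m" "j < n"
  shows "(C *\<^sub>v unit_vec n j) $ i = C $$ (i, j)"
  using assms by (subst index_mult_mat_vec) auto

lemma form_eq_sum:
  fixes A :: "'a :: comm_semiring_0 mat"
  assumes A: "A \<in> carrier_mat d d" and v: "v \<in> carrier_vec d"
  shows "v \<bullet> (A *\<^sub>v v) = (\<Sum>i<d. \<Sum>j<d. v $ i * A $$ (i, j) * v $ j)"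
proof -
  have "(A *\<^sub>v v) $ i = (\<Sum>j<d. A $$ (i, j) * v $ j)" if "i < d" for i
    using that v A by (simp add: scalar_prod_def lessThan_atLeast0)
  moreover have "dim_vec (A *\<^sub>v v) = d" using A by simp
  ultimately show ?thesis
    by (simp add: scalar_prod_def[of v] lessThan_atLeast0[symmetric] sum_distrib_left mult.assoc)
qed

context psd_mat
begin

lemma entry_eq_form:
  assumes "i < d" "j < d"
  shows "B $$ (i, j) = unit_vec d i \<bullet> (B *\<^sub>v unit_vec d j)"
  using assms mult_unit_vec_index[OF carrier] by simp

lemma diag_nonneg: "i < d \<Longrightarrow> 0 \<le> B $$ (i, i)"
  using form_nonneg[of "unit_vec d i"] entry_eq_form[of i i] by simp

lemma entry_sq_le:
  assumes "i < d" "j < d"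
  shows "(B $$ (i, j))\<^sup>2 \<le> B $$ (i, i) * B $$ (j, j)"
  using form_cauchy_schwarz[of "unit_vec d i" "unit_vec d j"] assms
  by (simp add: entry_eq_form del: scalar_prod_left_unit)

text \<open>Cauchy-Schwarz at unit vectors bounds every entry by \<open>c\<close>, and
  \<open>v\<^sub>i v\<^sub>j\<close> is at most the mean of the squares. The lost factor
  \<open>d\<close> is affordable: it ends up in the logarithm of the iteration count.\<close>

lemma form_le_diag:
  assumes diag: "\<And>i. i < d \<Longrightarrow> B $$ (i, i) \<le> c" and v: "v \<in> carrier_vec d"
  shows "v \<bullet> (B *\<^sub>v v) \<le> real d * c * (v \<bullet> v)"
proof -
  have vv: "v \<bullet> v = (\<Sum>i<d. (v $ i)\<^sup>2)"
    using v by (simp add: scalar_prod_def lessThan_atLeast0 power2_eq_square)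
  have "v $ i * B $$ (i, j) * v $ j \<le> c * (((v $ i)\<^sup>2 + (v $ j)\<^sup>2) / 2)" if "i < d" "j < d" for i j
  proof -
    have c: "0 \<le> c" using diag_nonneg diag that by force
    have "(B $$ (i, j))\<^sup>2 \<le> c\<^sup>2"
      using entry_sq_le[OF that] mult_mono[OF diag[OF that(1)] diag[OF that(2)] c diag_nonneg[OF that(2)]]
      by (simp add: power2_eq_square)
    then have B: "\<bar>B $$ (i, j)\<bar> \<le> c" using power2_le_imp_le[of "\<bar>B $$ (i, j)\<bar>" c] c by simp
    have "v $ i * B $$ (i, j) * v $ j \<le> \<bar>B $$ (i, j)\<bar> * \<bar>v $ i * v $ j\<bar>"
      using abs_ge_self[of "B $$ (i, j) * (v $ i * v $ j)"] by (simp add: abs_mult ac_simps)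
    also have "\<dots> \<le> c * (((v $ i)\<^sup>2 + (v $ j)\<^sup>2) / 2)"
    proof (intro mult_mono B c)
      show "\<bar>v $ i * v $ j\<bar> \<le> ((v $ i)\<^sup>2 + (v $ j)\<^sup>2) / 2"
        using sum_squares_bound[of "\<bar>v $ i\<bar>" "\<bar>v $ j\<bar>"] by (simp add: abs_mult)
    qed simp
    finally show ?thesis .
  qed
  then have "v \<bullet> (B *\<^sub>v v) \<le> (\<Sum>i<d. \<Sum>j<d. c * (((v $ i)\<^sup>2 + (v $ j)\<^sup>2) / 2))"
    unfolding form_eq_sum[OF carrier v] by (intro sum_mono) auto
  also have "\<dots> = real d * c * (v \<bullet> v)"
    unfolding vv by (simp add: sum.distrib sum_divide_distrib[symmetric] sum_distrib_left[symmetric]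
        add_divide_distrib algebra_simps)
  finally show ?thesis .
qed

lemma psd_mat_pow: "psd_mat (B ^\<^sub>m k) d"
proof
  show C: "B ^\<^sub>m k \<in> carrier_mat d d" using carrier by simp
  have entry: "(B ^\<^sub>m k) $$ (i, j) = unit_vec d i \<bullet> ((B ^\<^sub>m k) *\<^sub>v unit_vec d j)" if "i < d" "j < d" for i j
    using that mult_unit_vec_index[OF C] by simp
  have "(B ^\<^sub>m k) $$ (i, j) = (B ^\<^sub>m k) $$ (j, i)" if "i < d" "j < d" for i j
    unfolding entry[OF that] entry[OF that(2,1)]
    using pow_self_adjoint[of "unit_vec d i" "unit_vec d j" k]
    by (simp add: comm_scalar_prod[of "(B ^\<^sub>m k) *\<^sub>v unit_vec d i" d "unit_vec d j"])
  then have "transpose_mat (B ^\<^sub>m k) = B ^\<^sub>m k"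
    using carrier_matD[OF C] by (intro eq_matI) (simp_all del: pow_mat_dim)
  then show "positive_semidefinite (B ^\<^sub>m k)"
    using C moment_nonneg carrier unfolding positive_semidefinite_def moment_def by (auto simp: square_mat.simps)
qed

end

text \<open>
  The event on which a power iteration succeeds. It only compares entries, so that it is visibly
  measurable in \<open>B\<close> and \<open>g\<close> jointly, whereas a top eigenvector would require a measurable choice.
\<close>

definition good_draw :: "nat \<Rightarrow> real \<Rightarrow> real mat \<Rightarrow> real vec \<Rightarrow> bool" where
  "good_draw k p B g \<longleftrightarrow>
     p * (g \<bullet> g) \<le> real (dim_row B) \<and>
     (\<exists>j<dim_row B. (\<forall>i<dim_row B. (B ^\<^sub>m k) $$ (i, i) \<le> (B ^\<^sub>m k) $$ (j, j)) \<and>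
        p / 2 * (B ^\<^sub>m k) $$ (j, j) \<le> \<bar>((B ^\<^sub>m k) *\<^sub>v g) $ j\<bar>)"

section \<open>Off-diagonal estimate for a power iterate\<close>

context psd_mat
begin

text \<open>Cauchy-Schwarz for the form of \<open>B ^\<^sub>m k\<close> between
  \<open>unit_vec d j\<close> and \<open>g\<close>: the square of coordinate \<open>j\<close> is at
  most the diagonal entry times \<open>moment g k\<close>, and one factor of that entry
  cancels.\<close>

lemma moment_ge_of_coordinate:
  assumes g: "g \<in> carrier_vec d" and j: "j < d" and "0 \<le> p"
    and ge: "p * (B ^\<^sub>m k) $$ (j, j) \<le> \<bar>((B ^\<^sub>m k) *\<^sub>v g) $ j\<bar>"
  shows "p\<^sup>2 * (B ^\<^sub>m k) $$ (j, j) \<le> moment g k"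
proof -
  interpret C: psd_mat "B ^\<^sub>m k" d by (rule psd_mat_pow)
  define c where "c = (B ^\<^sub>m k) $$ (j, j)"
  have c: "0 \<le> c" unfolding c_def using j by (rule C.diag_nonneg)
  have "(p * c)\<^sup>2 \<le> (((B ^\<^sub>m k) *\<^sub>v g) $ j)\<^sup>2"
    using power_mono[OF ge, of 2] c \<open>0 \<le> p\<close> by (simp add: c_def)
  also have "\<dots> = (unit_vec d j \<bullet> ((B ^\<^sub>m k) *\<^sub>v g))\<^sup>2"
    using scalar_prod_left_unit[OF C.mult_carrier[OF g] j] by simp
  also have "\<dots> \<le> c * moment g k"
    using C.form_cauchy_schwarz[of "unit_vec d j" g] g C.entry_eq_form[OF j j]
    by (simp add: c_def moment_def)
  finally have *: "c * (p\<^sup>2 * c) \<le> c * moment g k" by (simp add: power2_eq_square ac_simps)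
  show ?thesis
  proof (cases "c = 0")
    case True
    then show ?thesis using moment_nonneg[OF g, of k] by (simp add: c_def)
  next
    case False
    then have "p\<^sup>2 * c \<le> moment g k" using * c by simp
    then show ?thesis by (simp add: c_def)
  qed
qed

text \<open>The left side is the form of \<open>(\<mu> - B)\<^sup>2 B ^ n\<close> at
  \<open>g\<close>. Its excess over \<open>e\<^sup>2 * moment g (Suc (Suc n))\<close> is
  \<open>\<mu> * M n - (1 + e) * M (Suc n)\<close>, which is positive only if the ratio of
  \<open>M\<close> at \<open>n\<close> is below \<open>\<mu> / (1 + e)\<close>; then all earlier
  ratios are small too and \<open>M n\<close> has decayed geometrically.\<close>

lemma shifted_moment_le:
  assumes g: "g \<in> carrier_vec d" and e: "0 < e" "e \<le> 1" and \<mu>: "0 \<le> \<mu>"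
    and le: "\<And>y. y \<in> carrier_vec d \<Longrightarrow> y \<bullet> (B *\<^sub>v y) \<le> \<mu> * (y \<bullet> y)"
  shows "\<mu>\<^sup>2 * moment g n - 2 * \<mu> * moment g (Suc n) + moment g (Suc (Suc n))
    \<le> e\<^sup>2 * moment g (Suc (Suc n)) + \<mu> ^ Suc (Suc n) * (1 / (1 + e)) ^ n * (g \<bullet> g)"
proof -
  define M where "M k = \<mu> * moment g k - (1 - e) * moment g (Suc k)" for k
  have a0: "(1 - e) * moment x 1 \<le> \<mu> * moment x 0" if "x \<in> carrier_vec d" for x
  proof -
    have "(1 - e) * moment x 1 \<le> 1 * moment x 1"
      using e moment_nonneg[OF that, of 1] by (intro mult_right_mono) auto
    also have "\<dots> \<le> \<mu> * moment x 0" using le[OF that] that by (simp add: moment_0 moment_1)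
    finally show ?thesis .
  qed
  have a1: "(1 - e) * moment x 2 \<le> \<mu> * moment x 1" if "x \<in> carrier_vec d" for x
  proof -
    have "(1 - e) * moment x 2 \<le> 1 * moment x 2"
      using e moment_nonneg[OF that, of 2] by (intro mult_right_mono) auto
    also have "\<dots> \<le> \<mu> * moment x 1" using moment_2_le[OF le that] by simp
    finally show ?thesis .
  qed
  have M_nonneg: "0 \<le> M k" for k
    unfolding M_def by (rule shifted_moment_nonneg[OF a0 a1 g])
  have M_logconvex: "(M (Suc k))\<^sup>2 \<le> M k * M (Suc (Suc k))" for k
    unfolding M_def by (rule shifted_moment_logconvex[OF a0 a1 g])
  \<comment> \<open>The factorisation of \<open>(\<mu> - x)\<^sup>2 - (e x)\<^sup>2\<close> into
    \<open>\<mu> - (1 - e) x\<close> and \<open>\<mu> - (1 + e) x\<close>, read on moments.\<close>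
  have expand: "\<mu>\<^sup>2 * moment g n - 2 * \<mu> * moment g (Suc n) + moment g (Suc (Suc n))
      - e\<^sup>2 * moment g (Suc (Suc n)) = \<mu> * M n - (1 + e) * M (Suc n)"
    unfolding M_def by (simp add: algebra_simps power2_eq_square)
  have rest: "0 \<le> \<mu> ^ Suc (Suc n) * (1 / (1 + e)) ^ n * (g \<bullet> g)"
    using e \<mu> self_scalar_prod_nonneg[of g] by (intro mult_nonneg_nonneg) auto
  show ?thesis
  proof (cases "\<mu> * M n \<le> (1 + e) * M (Suc n)")
    case True
    then show ?thesis using expand rest by linarith
  next
    case False
    define r where "r = \<mu> / (1 + e)"
    have r: "0 \<le> r" using e \<mu> by (simp add: r_def)
    have "M (Suc n) < r * M n" using False e by (simp add: r_def field_simps)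
    from logconvex_decay[of M, OF M_nonneg M_logconvex r this]
    have "M n \<le> r ^ n * M 0" .
    also have "\<dots> \<le> r ^ n * (\<mu> * (g \<bullet> g))"
      using r e moment_nonneg[OF g, of 1] g
      by (intro mult_left_mono) (auto simp: M_def moment_0)
    finally have "\<mu> * M n \<le> \<mu> * (r ^ n * (\<mu> * (g \<bullet> g)))"
      using \<mu> by (intro mult_left_mono) auto
    also have "\<dots> = \<mu> ^ Suc (Suc n) * (1 / (1 + e)) ^ n * (g \<bullet> g)"
      by (simp add: r_def power_divide)
    finally have "\<mu> * M n \<le> \<mu> ^ Suc (Suc n) * (1 / (1 + e)) ^ n * (g \<bullet> g)" .
    moreover have "0 \<le> (1 + e) * M (Suc n)" using e M_nonneg by simp
    ultimately show ?thesis using expand by linarith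
  qed
qed

text \<open>Write \<open>x = B w\<close>. For \<open>y\<close> orthogonal to \<open>x\<close>, the
  pairing of \<open>y\<close> with \<open>B x\<close> equals, up to sign, that with
  \<open>B (\<mu> w - x)\<close>, and Cauchy-Schwarz leaves only the form of \<open>B\<close> at
  \<open>\<mu> w - x\<close>, a shifted moment.\<close>

lemma power_iterate_off_diagonal:
  assumes g: "g \<in> carrier_vec d" and good: "good_draw (2 * t + 1) p B g"
    and t: "0 < t" and e: "0 < e" "e \<le> 1" and p: "0 < p"
    and iters: "4 * (real d)\<^sup>2 * (1 / (1 + e)) ^ (2 * t - 1) \<le> e\<^sup>2 * p ^ 3"
    and y: "y \<in> carrier_vec d" and orth: "y \<bullet> ((B ^\<^sub>m t) *\<^sub>v g) = 0"
  defines "x \<equiv> (B ^\<^sub>m t) *\<^sub>v g"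
  shows "(y \<bullet> (B *\<^sub>v x))\<^sup>2 \<le> (2 * e)\<^sup>2 * (x \<bullet> (B *\<^sub>v x)) * (y \<bullet> (B *\<^sub>v y))"
proof -
  define k where "k = 2 * t + 1"
  obtain n where n: "2 * t = Suc n" using t by (cases "2 * t") auto
  \<comment> \<open>The odd exponent \<open>k\<close> is that of the form at the iterate:
    \<open>x \<bullet> (B *\<^sub>v x) = moment g k\<close>.\<close>
  have k: "k = Suc (Suc n)" "0 < k" by (simp_all add: k_def n)
  interpret C: psd_mat "B ^\<^sub>m k" d by (rule psd_mat_pow)
  have dim: "dim_row B = d" using carrier by simp
  obtain j where j: "j < d"
    and max: "\<And>i. i < d \<Longrightarrow> (B ^\<^sub>m k) $$ (i, i) \<le> (B ^\<^sub>m k) $$ (j, j)"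
    and ge: "p / 2 * (B ^\<^sub>m k) $$ (j, j) \<le> \<bar>((B ^\<^sub>m k) *\<^sub>v g) $ j\<bar>"
    and gg: "p * (g \<bullet> g) \<le> real d"
    using good unfolding good_draw_def dim k_def[symmetric] by blast
  define c where "c = (B ^\<^sub>m k) $$ (j, j)"
  \<comment> \<open>With this root, \<open>\<mu> ^ k\<close> bounds the form of
    \<open>B ^\<^sub>m k\<close> by its diagonal, hence \<open>\<mu>\<close> bounds the form of
    \<open>B\<close>. The same entry \<open>c\<close> bounds \<open>moment g k\<close> from
    below.\<close>
  define \<mu> where "\<mu> = root k (real d * c)"
  have c: "0 \<le> c" unfolding c_def using j by (rule C.diag_nonneg)
  have \<mu>: "0 \<le> \<mu>" using c by (simp add: \<mu>_def k)
  have \<mu>k: "\<mu> ^ k = real d * c" using c k(2) unfolding \<mu>_def by (intro real_root_pow_pos2) auto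
  have le: "v \<bullet> (B *\<^sub>v v) \<le> \<mu> * (v \<bullet> v)" if v: "v \<in> carrier_vec d" for v
  proof (rule form_le_of_moment_le[OF \<mu> k(2) _ v])
    show "moment v k \<le> \<mu> ^ k * (v \<bullet> v)"
      unfolding moment_def \<mu>k using max v by (intro C.form_le_diag) (simp_all add: c_def)
  qed
  \<comment> \<open>One factor \<open>p\<close> pays for \<open>g \<bullet> g\<close>, the factor
    \<open>(p / 2)\<^sup>2\<close> for the lower bound on \<open>moment g k\<close>: together
    \<open>p ^ 3\<close> and the constant 4. The two factors \<open>d\<close> come from
    \<open>\<mu> ^ k\<close> and from \<open>g \<bullet> g\<close>.\<close>
  have small: "\<mu> ^ k * (1 / (1 + e)) ^ n * (g \<bullet> g) \<le> e\<^sup>2 * moment g k"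
  proof -
    have n': "n = 2 * t - 1" using n by simp
    have "p * (\<mu> ^ k * (1 / (1 + e)) ^ n * (g \<bullet> g)) =
        real d * c * (1 / (1 + e)) ^ n * (p * (g \<bullet> g))" by (simp add: \<mu>k)
    also have "\<dots> \<le> real d * c * (1 / (1 + e)) ^ n * real d"
      using gg c e by (intro mult_left_mono) auto
    also have "\<dots> = c * (4 * (real d)\<^sup>2 * (1 / (1 + e)) ^ n) / 4" by (simp add: power2_eq_square)
    also have "\<dots> \<le> c * (e\<^sup>2 * p ^ 3) / 4"
      using iters c unfolding n'[symmetric] by (intro divide_right_mono mult_left_mono) auto
    also have "\<dots> = p * (e\<^sup>2 * ((p / 2)\<^sup>2 * c))" by (simp add: power2_eq_square power3_eq_cube)
    also have "\<dots> \<le> p * (e\<^sup>2 * moment g k)"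
      using moment_ge_of_coordinate[OF g j _ ge] p by (intro mult_left_mono) (auto simp: c_def)
    finally show ?thesis using p by simp
  qed
  obtain s where s: "t = Suc s" using t by (cases t) auto
  define w where "w = (B ^\<^sub>m s) *\<^sub>v g"
  have w: "w \<in> carrier_vec d" and x: "x \<in> carrier_vec d" using g by (simp_all add: w_def x_def)
  have x_eq: "x = B *\<^sub>v w"
    unfolding x_def w_def s using g by (simp only: pow_Suc_mult mult_pow_commute)
  have n_eq: "n = 2 * s + 1" using n s by simp
  define z where "z = \<mu> \<cdot>\<^sub>v w - x"
  have z: "z \<in> carrier_vec d" using w x by (simp add: z_def)
  have Bz: "B *\<^sub>v z = \<mu> \<cdot>\<^sub>v x - B *\<^sub>v x"
    unfolding z_def using carrier w x by (simp add: mult_minus_distrib_mat_vec[of _ d d] mult_mat_vec[of _ d d] x_eq)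
  have yBz: "y \<bullet> (B *\<^sub>v z) = - (y \<bullet> (B *\<^sub>v x))"
    unfolding Bz using x y orth by (simp add: scalar_prod_minus_distrib[of _ d] x_def[symmetric])
  have m: "w \<bullet> x = moment g n" "x \<bullet> x = moment g (Suc n)" "w \<bullet> (B *\<^sub>v x) = moment g (Suc n)"
    "x \<bullet> (B *\<^sub>v x) = moment g k"
  proof -
    have Bx: "B *\<^sub>v x = (B ^\<^sub>m Suc t) *\<^sub>v g"
      unfolding x_def using g by (simp only: pow_Suc_mult mult_pow_commute)
    show "w \<bullet> x = moment g n" "x \<bullet> x = moment g (Suc n)" "w \<bullet> (B *\<^sub>v x) = moment g (Suc n)"
      "x \<bullet> (B *\<^sub>v x) = moment g k"
      unfolding Bx unfolding x_def w_def moment_pow[OF g] k n_eq s by (simp_all add: mult_2)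
  qed
  have "z \<bullet> (B *\<^sub>v z) = \<mu>\<^sup>2 * moment g n - 2 * \<mu> * moment g (Suc n) + moment g k"
    unfolding Bz unfolding z_def using w x
    by (simp add: scalar_prod_minus_distrib[of _ d] minus_scalar_prod_distrib[of _ d] m
        power2_eq_square algebra_simps)
  \<comment> \<open>One \<open>e\<^sup>2\<close> comes from \<open>shifted_moment_le\<close>, the
    other from \<open>small\<close>.\<close>
  also have "\<dots> \<le> 2 * e\<^sup>2 * moment g k"
    using shifted_moment_le[OF g e \<mu> le, of n] small unfolding k by simp
  also have "\<dots> \<le> (2 * e)\<^sup>2 * moment g k"
    using moment_nonneg[OF g, of k] by (simp add: power_mult_distrib mult_right_mono)
  finally have zz: "z \<bullet> (B *\<^sub>v z) \<le> (2 * e)\<^sup>2 * (x \<bullet> (B *\<^sub>v x))" by (simp add: m)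
  have "(y \<bullet> (B *\<^sub>v x))\<^sup>2 \<le> (y \<bullet> (B *\<^sub>v y)) * (z \<bullet> (B *\<^sub>v z))"
    using form_cauchy_schwarz[OF y z] by (simp add: yBz)
  also have "\<dots> \<le> (y \<bullet> (B *\<^sub>v y)) * ((2 * e)\<^sup>2 * (x \<bullet> (B *\<^sub>v x)))"
    using zz form_nonneg[OF y] by (rule mult_left_mono)
  finally show ?thesis by (simp add: ac_simps)
qed

end

section \<open>Splitting off one direction by rank-one deflation\<close>

lemma outer_square_carrier[simp]: "v \<in> carrier_vec d \<Longrightarrow> outer_square v \<in> carrier_mat d d"
  by (auto simp: outer_square_def)

lemma outer_square_mult_vec:
  assumes "u \<in> carrier_vec d" "v \<in> carrier_vec d"
  shows "outer_square u *\<^sub>v v = (u \<bullet> v) \<cdot>\<^sub>v u"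
  using assms
  by (intro eq_vecI) (auto simp: outer_square_def scalar_prod_def sum_distrib_right intro!: sum.cong)

lemma transpose_outer_square: "transpose_mat (outer_square v) = outer_square v"
  by (intro eq_matI) (auto simp: outer_square_def)

lemma deflation_mult_vec:
  assumes "\<phi> \<in> carrier_vec d" "v \<in> carrier_vec d"
  shows "(1\<^sub>m d - outer_square \<phi>) *\<^sub>v v = v - (\<phi> \<bullet> v) \<cdot>\<^sub>v \<phi>"
  using assms by (simp add: minus_mult_distrib_mat_vec[of _ d d] outer_square_mult_vec)

lemma deflation_carrier[simp]: "v \<in> carrier_vec d \<Longrightarrow> 1\<^sub>m d - outer_square v \<in> carrier_mat d d"
  using outer_square_carrier by (rule minus_carrier_mat)

lemma congruence_form:
  fixes B S :: "real mat"
  assumes "B \<in> carrier_mat d d" "S \<in> carrier_mat d d" "transpose_mat S = S" "v \<in> carrier_vec d"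
  shows "v \<bullet> ((S * B * S) *\<^sub>v v) = (S *\<^sub>v v) \<bullet> (B *\<^sub>v (S *\<^sub>v v))"
proof -
  have Sv: "S *\<^sub>v v \<in> carrier_vec d" using assms by (metis mult_mat_vec_carrier)
  then have "B *\<^sub>v (S *\<^sub>v v) \<in> carrier_vec d" using assms by (metis mult_mat_vec_carrier)
  then show ?thesis
    using transpose_vec_mult_scalar[of S d d "B *\<^sub>v (S *\<^sub>v v)" v] assms Sv
    by (simp add: assoc_mult_mat_vec[of _ d d _ d])
qed

lemma (in psd_mat) deflation_spectral_bound:
  assumes \<phi>: "\<phi> \<in> carrier_vec d" and unit: "\<phi> \<bullet> \<phi> = 1 \<or> \<phi> = 0\<^sub>v d" and "0 \<le> e"
    and off: "\<And>y. y \<in> carrier_vec d \<Longrightarrow> y \<bullet> \<phi> = 0 \<Longrightarrow>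
      (y \<bullet> (B *\<^sub>v \<phi>))\<^sup>2 \<le> e\<^sup>2 * (\<phi> \<bullet> (B *\<^sub>v \<phi>)) * (y \<bullet> (B *\<^sub>v y))"
    and v: "v \<in> carrier_vec d"
  defines "P \<equiv> 1\<^sub>m d - outer_square \<phi>"
  defines "q \<equiv> (\<phi> \<bullet> (B *\<^sub>v \<phi>)) * (\<phi> \<bullet> v)\<^sup>2 + v \<bullet> ((P * B * P) *\<^sub>v v)"
  shows "(1 - e) * q \<le> v \<bullet> (B *\<^sub>v v)" "v \<bullet> (B *\<^sub>v v) \<le> (1 + e) * q"
proof -
  define c where "c = \<phi> \<bullet> v"
  define y where "y = v - c \<cdot>\<^sub>v \<phi>"
  have y: "y \<in> carrier_vec d" using v \<phi> by (simp add: y_def)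
  have P: "P \<in> carrier_mat d d" using \<phi> by (simp add: P_def)
  have PT: "transpose_mat P = P"
    unfolding P_def using \<phi> by (simp add: transpose_minus[of _ d d] transpose_outer_square)
  have q: "q = (\<phi> \<bullet> (B *\<^sub>v \<phi>)) * c\<^sup>2 + y \<bullet> (B *\<^sub>v y)"
    using congruence_form[OF carrier P PT v] deflation_mult_vec[OF \<phi> v]
    by (simp add: q_def c_def P_def y_def)
  have orth: "y \<bullet> \<phi> = 0"
    using unit v \<phi> comm_scalar_prod[OF v \<phi>]
    by (auto simp: y_def c_def minus_scalar_prod_distrib[of _ d])
  have v_eq: "v = y + c \<cdot>\<^sub>v \<phi>" using v \<phi> by (intro eq_vecI) (auto simp: y_def)
  define a b w where "a = \<phi> \<bullet> (B *\<^sub>v \<phi>)" and "b = y \<bullet> (B *\<^sub>v y)" and "w = y \<bullet> (B *\<^sub>v \<phi>)"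
  have a: "0 \<le> a" and b: "0 \<le> b" using form_nonneg y \<phi> by (simp_all add: a_def b_def)
  have vBv: "v \<bullet> (B *\<^sub>v v) = b + 2 * c * w + c\<^sup>2 * a"
    unfolding v_eq using form_add_smult[OF y \<phi>] by (simp add: a_def b_def w_def)
  \<comment> \<open>The cross term is compared through squares, which avoids the roots of
    \<open>a\<close> and \<open>b\<close>.\<close>
  have "(2 * c * w)\<^sup>2 = 4 * c\<^sup>2 * w\<^sup>2" by (simp add: power_mult_distrib)
  also have "\<dots> \<le> 4 * c\<^sup>2 * (e\<^sup>2 * a * b)"
    using off[OF y orth] by (intro mult_left_mono) (auto simp: a_def b_def w_def)
  also have "\<dots> = e\<^sup>2 * (4 * (c\<^sup>2 * a) * b)" by simp
  also have "\<dots> \<le> e\<^sup>2 * (c\<^sup>2 * a + b)\<^sup>2"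
  proof (rule mult_left_mono)
    have "0 \<le> (c\<^sup>2 * a - b)\<^sup>2" by simp
    then show "4 * (c\<^sup>2 * a) * b \<le> (c\<^sup>2 * a + b)\<^sup>2"
      unfolding power2_sum power2_diff by linarith
  qed simp
  finally have "\<bar>2 * c * w\<bar>\<^sup>2 \<le> (e * (c\<^sup>2 * a + b))\<^sup>2" by (simp add: power_mult_distrib)
  then have "\<bar>2 * c * w\<bar> \<le> e * (c\<^sup>2 * a + b)"
    by (rule power2_le_imp_le) (use a b \<open>0 \<le> e\<close> in simp)
  moreover have "q = c\<^sup>2 * a + b" by (simp add: q a_def b_def)
  ultimately show "(1 - e) * q \<le> v \<bullet> (B *\<^sub>v v)" "v \<bullet> (B *\<^sub>v v) \<le> (1 + e) * q"
    unfolding vBv by (simp_all add: algebra_simps abs_le_iff)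
qed

text \<open>After taking logarithms the claim is \<open>ln (4 d\<^sup>2 / (p ^ 3 e\<^sup>2)) \<le>
  (2 t - 1) ln (1 + e)\<close>. The left side is at most \<open>6 * \<Lambda>\<close> and
  \<open>ln (1 + e) \<ge> e / 2\<close>, so \<open>L \<ge> 12\<close> suffices.\<close>

lemma power_method_iters_bound:
  assumes L: "12 \<le> L" and d: "1 \<le> d" and e: "0 < e" "e \<le> 1 / 2" and p: "0 < p" "p \<le> 1 / 2"
  defines "t \<equiv> power_method_iters L d e p"
  shows "0 < t" "4 * (real d)\<^sup>2 * (1 / (1 + e)) ^ (2 * t - 1) \<le> e\<^sup>2 * p ^ 3"
proof -
  define \<Lambda> where "\<Lambda> = ln (real d) + ln (1 / p) + ln (1 / e)"
  have "2 \<le> 1 / p" "2 \<le> 1 / e" using e p by (auto simp: field_simps)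
  then have ln: "0 \<le> ln (real d)" "ln 2 \<le> ln (1 / p)" "ln 2 \<le> ln (1 / e)" "0 < ln (2::real)"
    using d e p by (auto simp del: ln_le_cancel_iff intro!: ln_mono)
  have \<Lambda>: "0 < \<Lambda>" unfolding \<Lambda>_def using ln by linarith
  have real_t: "L * (\<Lambda> / e) \<le> real t"
    unfolding t_def power_method_iters_def \<Lambda>_def by (rule real_nat_ceiling_ge)
  have "0 < L * (\<Lambda> / e)" using L \<Lambda> e by simp
  with real_t show t: "0 < t" using not_gr_zero by fastforce
  have "ln 4 = 2 * ln (2::real)" using ln_realpow[of 2 2] by simp
  moreover have "ln (4 * (real d)\<^sup>2 * (1 / p) ^ 3 * (1 / e)\<^sup>2) =
      ln 4 + 2 * ln (real d) + 3 * ln (1 / p) + 2 * ln (1 / e)"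
    using d e p by (simp add: ln_mult ln_realpow ln_div)
  \<comment> \<open>The summand \<open>ln 4\<close> is absorbed because \<open>1 / p\<close> and
    \<open>1 / e\<close> are at least 2.\<close>
  ultimately have "ln (4 * (real d)\<^sup>2 * (1 / p) ^ 3 * (1 / e)\<^sup>2) \<le> 6 * \<Lambda>"
    using ln unfolding \<Lambda>_def by argo
  also have "\<dots> \<le> (L * (\<Lambda> / e)) * (e / 2)" using L \<Lambda> e by (simp add: field_simps)
  also have "\<dots> \<le> real t * (e / 2)" using real_t e by (intro mult_right_mono) auto
  also have "\<dots> \<le> real (2 * t - 1) * ln (1 + e)"
  proof (rule mult_mono)
    \<comment> \<open>Used with \<open>e - e\<^sup>2 \<le> ln (1 + e)\<close>.\<close>
    have "e * e \<le> e * (1 / 2)" using e by (intro mult_left_mono) auto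
    then show "e / 2 \<le> ln (1 + e)"
      using ln_one_plus_pos_lower_bound[of e] e unfolding power2_eq_square by linarith
  qed (use t e in auto)
  finally have "exp (ln (4 * (real d)\<^sup>2 * (1 / p) ^ 3 * (1 / e)\<^sup>2)) \<le> exp (real (2 * t - 1) * ln (1 + e))"
    by simp
  also have "\<dots> = (1 + e) ^ (2 * t - 1)"
    using e by (simp add: exp_of_nat_mult)
  finally have "4 * (real d)\<^sup>2 * (1 / p) ^ 3 * (1 / e)\<^sup>2 \<le> (1 + e) ^ (2 * t - 1)"
    using d e p by simp
  then show "4 * (real d)\<^sup>2 * (1 / (1 + e)) ^ (2 * t - 1) \<le> e\<^sup>2 * p ^ 3"
    using e p by (simp add: field_simps power_divide)
qed

lemma vec_norm2_sq: "(vec_norm2 v)\<^sup>2 = v \<bullet> v"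
  by (simp add: vec_norm2_def self_scalar_prod_nonneg)

text \<open>The second alternative is the case of norm zero, where \<open>1 / 0 = 0\<close>.\<close>

lemma normalize_unit:
  assumes x: "x \<in> carrier_vec d"
  shows "((1 / vec_norm2 x) \<cdot>\<^sub>v x) \<bullet> ((1 / vec_norm2 x) \<cdot>\<^sub>v x) = 1 \<or>
    (1 / vec_norm2 x) \<cdot>\<^sub>v x = 0\<^sub>v d"
proof (cases "vec_norm2 x = 0")
  case True
  then show ?thesis using x by auto
next
  case False
  then have "x \<bullet> x \<noteq> 0" using vec_norm2_sq[of x] by auto
  then show ?thesis using x False vec_norm2_sq[of x] by (simp add: power2_eq_square)
qed

text \<open>The off-diagonal estimate is homogeneous in the iterate: normalisation multiplies both
  sides by \<open>a\<^sup>2\<close>. So it passes to \<open>\<phi>\<close> and feeds the deflation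
  bound.\<close>

lemma (in psd_mat) power_method_bound:
  assumes g: "g \<in> carrier_vec d" and L: "12 \<le> L" and d: "1 \<le> d"
    and e: "0 < e" "e \<le> 1 / 2" and p: "0 < p" "p \<le> 1 / 2"
    and good: "good_draw (2 * power_method_iters L d e p + 1) p B g"
    and v: "v \<in> carrier_vec d"
  defines "\<phi> \<equiv> power_method L B e p g"
  defines "P \<equiv> 1\<^sub>m d - outer_square \<phi>"
  defines "q \<equiv> (\<phi> \<bullet> (B *\<^sub>v \<phi>)) * (\<phi> \<bullet> v)\<^sup>2 + v \<bullet> ((P * B * P) *\<^sub>v v)"
  shows "(1 - 2 * e) * q \<le> v \<bullet> (B *\<^sub>v v)" "v \<bullet> (B *\<^sub>v v) \<le> (1 + 2 * e) * q"
proof -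
  define t where "t = power_method_iters L d e p"
  define x where "x = (B ^\<^sub>m t) *\<^sub>v g"
  define a where "a = 1 / vec_norm2 x"
  have x: "x \<in> carrier_vec d" using g by (simp add: x_def)
  have dim: "dim_row B = d" using carrier by simp
  have \<phi>_eq: "\<phi> = a \<cdot>\<^sub>v x"
    by (simp add: \<phi>_def power_method_def Let_def dim x_def t_def a_def)
  have \<phi>: "\<phi> \<in> carrier_vec d" using x by (simp add: \<phi>_eq)
  note iters = power_method_iters_bound[OF L d e p, folded t_def]
  have off: "(y \<bullet> (B *\<^sub>v \<phi>))\<^sup>2 \<le> (2 * e)\<^sup>2 * (\<phi> \<bullet> (B *\<^sub>v \<phi>)) * (y \<bullet> (B *\<^sub>v y))"
    if y: "y \<in> carrier_vec d" and orth: "y \<bullet> \<phi> = 0" for y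
  proof (cases "a = 0")
    case True
    then have "\<phi> = 0\<^sub>v d" using x by (auto simp: \<phi>_eq)
    moreover have "B *\<^sub>v 0\<^sub>v d = 0\<^sub>v d" using carrier by auto
    ultimately show ?thesis using y by simp
  next
    case False
    have "y \<bullet> x = 0" using orth False x y by (simp add: \<phi>_eq)
    then have *: "(y \<bullet> (B *\<^sub>v x))\<^sup>2 \<le> (2 * e)\<^sup>2 * (x \<bullet> (B *\<^sub>v x)) * (y \<bullet> (B *\<^sub>v y))"
      unfolding x_def using power_iterate_off_diagonal[OF g good[folded t_def] iters(1) e(1) _ p(1) iters(2) y] e
      by simp
    have B\<phi>: "B *\<^sub>v \<phi> = a \<cdot>\<^sub>v (B *\<^sub>v x)" unfolding \<phi>_eq using x carrier by (simp add: mult_mat_vec)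
    have "(y \<bullet> (B *\<^sub>v \<phi>))\<^sup>2 = a\<^sup>2 * (y \<bullet> (B *\<^sub>v x))\<^sup>2"
      unfolding B\<phi> using x y by (simp add: power_mult_distrib)
    also have "\<dots> \<le> a\<^sup>2 * ((2 * e)\<^sup>2 * (x \<bullet> (B *\<^sub>v x)) * (y \<bullet> (B *\<^sub>v y)))"
      using * by (intro mult_left_mono) auto
    also have "\<dots> = (2 * e)\<^sup>2 * (\<phi> \<bullet> (B *\<^sub>v \<phi>)) * (y \<bullet> (B *\<^sub>v y))"
      unfolding B\<phi> unfolding \<phi>_eq using x by (simp add: power2_eq_square)
    finally show ?thesis .
  qed
  have unit: "\<phi> \<bullet> \<phi> = 1 \<or> \<phi> = 0\<^sub>v d" unfolding \<phi>_eq a_def using x by (rule normalize_unit)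
  have "0 \<le> 2 * e" using e by simp
  from deflation_spectral_bound[OF \<phi> unit this off v]
  show "(1 - 2 * e) * q \<le> v \<bullet> (B *\<^sub>v v)" "v \<bullet> (B *\<^sub>v v) \<le> (1 + 2 * e) * q"
    unfolding q_def P_def by blast+
qed

section \<open>Deflation\<close>

lemma loewner_leI:
  assumes X: "X \<in> carrier_mat d d" "transpose_mat X = X"
    and Y: "Y \<in> carrier_mat d d" "transpose_mat Y = Y"
    and le: "\<And>v. v \<in> carrier_vec d \<Longrightarrow> v \<bullet> (X *\<^sub>v v) \<le> v \<bullet> (Y *\<^sub>v v)"
  shows "X \<preceq>\<^sub>L Y"
proof -
  have dim: "dim_row (Y - X) = d" "dim_col (Y - X) = d" using X(1) by auto
  have "transpose_mat (Y - X) = Y - X"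
    using transpose_minus[OF Y(1) X(1)] X(2) Y(2) by simp
  moreover have "0 \<le> v \<bullet> ((Y - X) *\<^sub>v v)" if v: "v \<in> carrier_vec d" for v
  proof -
    have "v \<bullet> ((Y - X) *\<^sub>v v) = v \<bullet> (Y *\<^sub>v v) - v \<bullet> (X *\<^sub>v v)"
      using X Y v mult_mat_vec_carrier[OF X(1) v] mult_mat_vec_carrier[OF Y(1) v]
      by (simp add: minus_mult_distrib_mat_vec[of _ d d] scalar_prod_minus_distrib[of _ d])
    then show ?thesis using le[OF v] by simp
  qed
  ultimately have "positive_semidefinite (Y - X)"
    unfolding positive_semidefinite_def dim by (simp add: dim square_mat.simps del: index_minus_mat)
  then show ?thesis unfolding loewner_le_def using X Y by auto
qed

lemma transpose_congruence:
  fixes B S :: "real mat"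
  assumes "B \<in> carrier_mat d d" "transpose_mat B = B" "S \<in> carrier_mat d d" "transpose_mat S = S"
  shows "transpose_mat (S * B * S) = S * B * S"
  using assms
  by (simp add: transpose_mult[of _ d d _ d] assoc_mult_mat[of _ d d _ d _ d])

lemma transpose_smult: "transpose_mat (c \<cdot>\<^sub>m M) = c \<cdot>\<^sub>m transpose_mat M"
  by (intro eq_matI) auto

lemma congruence_mult_vec:
  fixes B S :: "real mat"
  assumes "B \<in> carrier_mat d d" "S \<in> carrier_mat d d" "v \<in> carrier_vec d"
  shows "(S * B * S) *\<^sub>v v = S *\<^sub>v (B *\<^sub>v (S *\<^sub>v v))"
  using assms mult_mat_vec_carrier[OF assms(2,3)] by (simp add: assoc_mult_mat_vec[of _ d d _ d])

lemma psd_mat_congruence: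
  assumes "psd_mat B d" "S \<in> carrier_mat d d" "transpose_mat S = S"
  shows "psd_mat (S * B * S) d"
proof
  interpret psd_mat B d by fact
  show C: "S * B * S \<in> carrier_mat d d" using assms carrier by auto
  have "transpose_mat (S * B * S) = S * B * S"
    using psd by (intro transpose_congruence[of _ d]) (auto simp: assms carrier positive_semidefinite_def)
  moreover have "0 \<le> v \<bullet> ((S * B * S) *\<^sub>v v)" if "v \<in> carrier_vec d" for v
    using that assms form_nonneg[of "S *\<^sub>v v"] mult_mat_vec_carrier[of S d d v]
    by (simp add: congruence_form[OF carrier])
  ultimately show "positive_semidefinite (S * B * S)"
    unfolding positive_semidefinite_def using carrier_matD[OF C] by (simp del: index_mult_mat)
qed

lemma mat_sum_carrier[simp]: "mat_sum d M I \<in> carrier_mat d d"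
  by (simp add: mat_sum_def)

lemma mat_sum_0: "mat_sum d M {..<0::nat} = 0\<^sub>m d d"
  by (intro eq_matI) (auto simp: mat_sum_def)

lemma mat_sum_Suc:
  "M i \<in> carrier_mat d d \<Longrightarrow> mat_sum d M {..<Suc i} = mat_sum d M {..<i} + M i"
  by (intro eq_matI) (auto simp: mat_sum_def)

lemma transpose_mat_sum:
  assumes "\<And>i. i \<in> I \<Longrightarrow> M i \<in> carrier_mat d d" "\<And>i. i \<in> I \<Longrightarrow> transpose_mat (M i) = M i"
  shows "transpose_mat (mat_sum d M I) = mat_sum d M I"
proof (rule eq_matI)
  fix j k assume "j < dim_row (mat_sum d M I)" "k < dim_col (mat_sum d M I)"
  then have jk: "j < d" "k < d" by (simp_all add: mat_sum_def)
  have "M i $$ (k, j) = M i $$ (j, k)" if "i \<in> I" for i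
  proof -
    have "transpose_mat (M i) $$ (j, k) = M i $$ (k, j)" using jk assms(1)[OF that] by auto
    then show ?thesis using assms(2)[OF that] by simp
  qed
  then show "transpose_mat (mat_sum d M I) $$ (j, k) = mat_sum d M I $$ (j, k)"
    using jk by (simp add: mat_sum_def)
qed (simp_all add: mat_sum_def)

lemma mat_sum_form:
  fixes M :: "nat \<Rightarrow> real mat"
  assumes M: "\<And>i. M i \<in> carrier_mat d d" and v: "v \<in> carrier_vec d"
  shows "v \<bullet> (mat_sum d M {..<n} *\<^sub>v v) = (\<Sum>i<n. v \<bullet> (M i *\<^sub>v v))"
proof (induction n)
  case 0
  have "0\<^sub>m d d *\<^sub>v v = 0\<^sub>v d" using v by auto
  then show ?case using v by (simp add: mat_sum_0[simplified])
next
  case (Suc n)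
  have "mat_sum d M {..<Suc n} *\<^sub>v v = mat_sum d M {..<n} *\<^sub>v v + M n *\<^sub>v v"
    unfolding mat_sum_Suc[OF M] by (rule add_mult_distrib_mat_vec[OF mat_sum_carrier M v])
  then show ?case
    using Suc scalar_prod_add_distrib[OF v mult_mat_vec_carrier[OF mat_sum_carrier v]
      mult_mat_vec_carrier[OF M v], of M "{..<n}" n]
    by simp
qed

text \<open>A relative error on \<open>q\<close> alone is also one on \<open>T + q\<close> when
  \<open>T\<close> is nonnegative; \<open>T\<close> will be the part already split off by earlier
  steps.\<close>

lemma add_relative_bounds:
  fixes e T q b :: real
  assumes "0 \<le> e" "0 \<le> T" "(1 - e) * q \<le> b" "b \<le> (1 + e) * q"
  shows "(1 - e) * (T + q) \<le> T + b" "T + b \<le> (1 + e) * (T + q)"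
  using assms mult_nonneg_nonneg[OF assms(1,2)] unfolding ring_distribs mult_1 by linarith+

section \<open>A run of the deflation for fixed draws\<close>

locale pca_run =
  fixes A :: "real mat" and d l :: nat and L \<epsilon> \<delta> :: real and g :: "nat \<Rightarrow> real vec"
  assumes A: "psd_mat A d"
    and g: "\<And>i. g i \<in> carrier_vec d"
    and ld: "1 \<le> l" "l \<le> d"
    and L: "12 \<le> L"
    and \<epsilon>: "0 < \<epsilon>" "\<epsilon> \<le> 1"
    and \<delta>: "0 < \<delta>" "\<delta> \<le> 1"
begin

definition e :: real where "e = \<epsilon> / (2 * real l)"
definition p :: real where "p = \<delta> / (2 * real l)"
definition t :: nat where "t = power_method_iters L d e p"

abbreviation B :: "nat \<Rightarrow> real mat" where "B \<equiv> pca_mat L A l \<epsilon> \<delta> g"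
abbreviation \<phi> :: "nat \<Rightarrow> real vec" where "\<phi> \<equiv> pca_vec L A l \<epsilon> \<delta> g"
abbreviation P :: "nat \<Rightarrow> real mat" where "P i \<equiv> 1\<^sub>m d - outer_square (\<phi> i)"
definition R :: "nat \<Rightarrow> real mat" where
  "R i = 1\<^sub>m d - mat_sum d (\<lambda>j. outer_square (\<phi> j)) {..<i}"

lemma A_carrier[simp]: "A \<in> carrier_mat d d"
  using A by (rule psd_mat.carrier)

lemma e_bounds: "0 < e" "e \<le> 1 / 2" "2 * e \<le> \<epsilon>"
  using \<epsilon> ld mult_left_mono[of 1 "real l" \<epsilon>] by (auto simp: e_def field_simps)

lemma p_bounds: "0 < p" "p \<le> 1 / 2"
  using \<delta> ld by (auto simp: p_def field_simps)

lemma t_pos: "0 < t"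
  using power_method_iters_bound(1)[OF L _ e_bounds(1,2) p_bounds] ld by (simp add: t_def)

lemma B_Suc: "B (Suc i) = P i * B i * P i"
  using carrier_matD[OF A_carrier] by (simp add: pca_vec_def Let_def)

text \<open>Since \<open>t\<close> is positive, the output lies in the range of \<open>B i\<close>.
  Positive semidefiniteness of \<open>B i\<close> is a premise because this lemma serves inside the
  induction that proves it.\<close>

lemma \<phi>_eq:
  assumes "psd_mat (B i) d"
  obtains w where "w \<in> carrier_vec d" "\<phi> i = B i *\<^sub>v w"
    "\<phi> i \<bullet> \<phi> i = 1 \<or> \<phi> i = 0\<^sub>v d"
proof -
  interpret psd_mat "B i" d by fact
  obtain s where s: "t = Suc s" using t_pos by (cases t) auto
  define x where "x = (B i ^\<^sub>m t) *\<^sub>v g i"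
  have x: "x \<in> carrier_vec d" using g by (simp add: x_def)
  have \<phi>: "\<phi> i = (1 / vec_norm2 x) \<cdot>\<^sub>v x"
    using carrier_matD[OF carrier]
    by (simp add: pca_vec_def power_method_def Let_def x_def t_def e_def p_def)
  have "x = B i *\<^sub>v ((B i ^\<^sub>m s) *\<^sub>v g i)"
    unfolding x_def s using g by (simp only: pow_Suc_mult mult_pow_commute)
  then have "\<phi> i = B i *\<^sub>v ((1 / vec_norm2 x) \<cdot>\<^sub>v ((B i ^\<^sub>m s) *\<^sub>v g i))"
    unfolding \<phi> using g carrier by (simp add: mult_mat_vec[of _ d d])
  moreover have "\<phi> i \<bullet> \<phi> i = 1 \<or> \<phi> i = 0\<^sub>v d" unfolding \<phi> using x by (rule normalize_unit)
  ultimately show ?thesis using g that by (meson pow_mult_carrier smult_carrier_vec)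
qed

lemma P_transpose: "\<phi> i \<in> carrier_vec d \<Longrightarrow> transpose_mat (P i) = P i"
  by (simp add: transpose_minus[of _ d d] transpose_outer_square)

lemma psd_B: "psd_mat (B i) d"
proof (induction i)
  case 0
  then show ?case using A by simp
next
  case (Suc i)
  then interpret psd_mat "B i" d .
  obtain w where "w \<in> carrier_vec d" "\<phi> i = B i *\<^sub>v w" by (rule \<phi>_eq[OF Suc])
  then have "\<phi> i \<in> carrier_vec d" by simp
  then show ?case
    unfolding B_Suc using Suc by (intro psd_mat_congruence P_transpose) auto
qed

lemma \<phi>_unit: "\<phi> i \<bullet> \<phi> i = 1 \<or> \<phi> i = 0\<^sub>v d"
  by (rule \<phi>_eq[OF psd_B])

lemma \<phi>_carrier[simp]: "\<phi> i \<in> carrier_vec d"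
  by (rule \<phi>_eq[OF psd_B, of i]) (simp add: psd_mat.mult_carrier[OF psd_B])

lemma dim_\<phi>[simp]: "dim_vec (\<phi> i) = d"
  using \<phi>_carrier by (rule carrier_vecD)

lemma P_carrier: "P i \<in> carrier_mat d d"
  by simp

text \<open>The range of the symmetric matrix \<open>B i\<close> is orthogonal to its
  kernel.\<close>

lemma \<phi>_orthogonal_of_kernel:
  assumes "v \<in> carrier_vec d" "B i *\<^sub>v v = 0\<^sub>v d"
  shows "v \<bullet> \<phi> i = 0"
proof -
  interpret psd_mat "B i" d by (rule psd_B)
  obtain w where w: "w \<in> carrier_vec d" and "\<phi> i = B i *\<^sub>v w" by (rule \<phi>_eq[OF psd_B])
  then have "v \<bullet> \<phi> i = (B i *\<^sub>v v) \<bullet> w" using self_adjoint[OF assms(1) w] by simp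
  then show ?thesis using assms(2) w by simp
qed

text \<open>The deflation at step \<open>i\<close> annihilates \<open>\<phi> i\<close>, whether a
  unit vector or zero. An earlier \<open>\<phi> j\<close> lies in the kernel of \<open>B i\<close>,
  hence is orthogonal to \<open>\<phi> i\<close> and fixed by \<open>P i\<close>, so it stays in the
  kernel.\<close>

lemma B_kernel: "j < i \<Longrightarrow> B i *\<^sub>v \<phi> j = 0\<^sub>v d"
proof (induction i)
  case (Suc i)
  interpret psd_mat "B i" d by (rule psd_B)
  have "B i *\<^sub>v (P i *\<^sub>v \<phi> j) = 0\<^sub>v d"
  proof (cases "j = i")
    case True
    have "P i *\<^sub>v \<phi> i = 0\<^sub>v d"
      using \<phi>_unit[of i] \<phi>_carrier[of i] unfolding deflation_mult_vec[OF \<phi>_carrier \<phi>_carrier] by auto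
    then show ?thesis using True carrier by auto
  next
    case False
    then have ker: "B i *\<^sub>v \<phi> j = 0\<^sub>v d" using Suc by simp
    have "\<phi> i \<bullet> \<phi> j = 0"
      using \<phi>_orthogonal_of_kernel[OF _ ker] comm_scalar_prod[of "\<phi> i" d "\<phi> j"] by simp
    then have "P i *\<^sub>v \<phi> j = \<phi> j"
      unfolding deflation_mult_vec[OF \<phi>_carrier \<phi>_carrier] using \<phi>_carrier[of i] \<phi>_carrier[of j]
      by (intro eq_vecI) auto
    then show ?thesis using ker by simp
  qed
  moreover have "B (Suc i) *\<^sub>v \<phi> j = P i *\<^sub>v (B i *\<^sub>v (P i *\<^sub>v \<phi> j))"
    unfolding B_Suc by (rule congruence_mult_vec[OF carrier P_carrier \<phi>_carrier])
  moreover have "M *\<^sub>v 0\<^sub>v d = 0\<^sub>v d" if "M \<in> carrier_mat d d" for M :: "real mat"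
    using that by auto
  ultimately show ?case using P_carrier by metis
qed simp

lemma \<phi>_orthogonal: "j < i \<Longrightarrow> \<phi> j \<bullet> \<phi> i = 0"
  using \<phi>_orthogonal_of_kernel[OF _ B_kernel] by simp

lemma R_carrier[simp]: "R i \<in> carrier_mat d d"
  unfolding R_def by (rule minus_carrier_mat) simp

lemma R_transpose: "transpose_mat (R i) = R i"
  unfolding R_def
  by (simp add: transpose_minus[of _ d d] transpose_mat_sum transpose_outer_square)

lemma R_mult_carrier[simp]: "v \<in> carrier_vec d \<Longrightarrow> R i *\<^sub>v v \<in> carrier_vec d"
  using R_carrier by (rule mult_mat_vec_carrier)

lemma R_0: "v \<in> carrier_vec d \<Longrightarrow> R 0 *\<^sub>v v = v"
  unfolding R_def mat_sum_0 by (simp add: minus_mult_distrib_mat_vec[of _ d d]) auto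

lemma R_Suc:
  assumes v: "v \<in> carrier_vec d"
  shows "R (Suc i) *\<^sub>v v = R i *\<^sub>v v - (\<phi> i \<bullet> v) \<cdot>\<^sub>v \<phi> i"
proof -
  let ?S = "mat_sum d (\<lambda>j. outer_square (\<phi> j)) {..<i}"
  have S: "?S *\<^sub>v v \<in> carrier_vec d" using v by (intro mult_mat_vec_carrier) auto
  have "R (Suc i) *\<^sub>v v = v - (?S *\<^sub>v v + (\<phi> i \<bullet> v) \<cdot>\<^sub>v \<phi> i)"
    unfolding R_def using v
    by (subst mat_sum_Suc) (simp_all add: minus_mult_distrib_mat_vec[of _ d d]
        add_mult_distrib_mat_vec[of _ d d] outer_square_mult_vec[of _ d])
  also have "\<dots> = (v - ?S *\<^sub>v v) - (\<phi> i \<bullet> v) \<cdot>\<^sub>v \<phi> i"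
    using v carrier_vecD[OF S] by (intro eq_vecI) (simp_all del: dim_mult_mat_vec index_mult_mat_vec)
  also have "v - ?S *\<^sub>v v = R i *\<^sub>v v"
    unfolding R_def using v by (simp add: minus_mult_distrib_mat_vec[of _ d d])
  finally show ?thesis .
qed

lemma R_fixes:
  assumes v: "v \<in> carrier_vec d" and "\<And>j. j < i \<Longrightarrow> \<phi> j \<bullet> v = 0"
  shows "R i *\<^sub>v v = v"
  using assms(2)
proof (induction i)
  case 0
  then show ?case using R_0[OF v] by simp
next
  case (Suc i)
  then have "R i *\<^sub>v v = v" "\<phi> i \<bullet> v = 0" by simp_all
  then show ?case using v \<phi>_carrier[of i] by (intro eq_vecI) (auto simp: R_Suc[OF v])
qed

text \<open>The iterated congruences collapse to one: \<open>R i\<close> fixes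
  \<open>\<phi> i\<close> by orthogonality, so \<open>R i\<close> after \<open>P i\<close> is
  \<open>R (Suc i)\<close>. This identifies the last deflated matrix with the residual term of
  \<open>pca_approx\<close>.\<close>

lemma B_form:
  "v \<in> carrier_vec d \<Longrightarrow> v \<bullet> (B i *\<^sub>v v) = (R i *\<^sub>v v) \<bullet> (A *\<^sub>v (R i *\<^sub>v v))"
proof (induction i arbitrary: v)
  case 0
  then show ?case by (simp add: R_0)
next
  case (Suc i)
  have Pv: "P i *\<^sub>v v \<in> carrier_vec d" using P_carrier Suc.prems by (rule mult_mat_vec_carrier)
  have R\<phi>: "R i *\<^sub>v \<phi> i = \<phi> i" by (intro R_fixes \<phi>_orthogonal) auto
  have "R i *\<^sub>v (P i *\<^sub>v v) = R (Suc i) *\<^sub>v v"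
    unfolding R_Suc[OF Suc.prems] deflation_mult_vec[OF \<phi>_carrier Suc.prems]
    using Suc.prems R_carrier[of i] \<phi>_carrier[of i] R\<phi>
    by (simp add: mult_minus_distrib_mat_vec[of _ d d] mult_mat_vec[of _ d d])
  moreover have "v \<bullet> (B (Suc i) *\<^sub>v v) = (P i *\<^sub>v v) \<bullet> (B i *\<^sub>v (P i *\<^sub>v v))"
    unfolding B_Suc
    by (rule congruence_form[OF psd_mat.carrier[OF psd_B] P_carrier P_transpose Suc.prems]) simp
  ultimately show ?case using Suc.IH[OF Pv] by simp
qed

text \<open>\<open>R i\<close> fixes \<open>\<phi> i\<close>, so the coefficient split off from
  \<open>B i\<close> is the one that \<open>pca_approx\<close> computes from
  \<open>A\<close>.\<close>

lemma \<phi>_form: "\<phi> i \<bullet> (B i *\<^sub>v \<phi> i) = \<phi> i \<bullet> (A *\<^sub>v \<phi> i)"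
proof -
  have "R i *\<^sub>v \<phi> i = \<phi> i" by (intro R_fixes \<phi>_orthogonal) auto
  then show ?thesis by (simp add: B_form)
qed

text \<open>The form of the approximation stopped after \<open>i\<close> steps: for
  \<open>i = 0\<close> it is that of \<open>A\<close>, for \<open>i = l\<close> that of
  \<open>pca_approx\<close>.\<close>

definition approx_form :: "nat \<Rightarrow> real vec \<Rightarrow> real" where
  "approx_form i v = (\<Sum>j<i. (\<phi> j \<bullet> (A *\<^sub>v \<phi> j)) * (\<phi> j \<bullet> v)\<^sup>2) + v \<bullet> (B i *\<^sub>v v)"

text \<open>Step \<open>i\<close> replaces only the residual form of \<open>B i\<close>, with
  relative error \<open>2 * e\<close>, and keeps the nonnegative sum \<open>T\<close> of earlier
  terms. The factors therefore multiply over the steps.\<close>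

lemma approx_form_bounds:
  assumes good: "\<And>j. j < i \<Longrightarrow> good_draw (2 * t + 1) p (B j) (g j)" and v: "v \<in> carrier_vec d"
  shows "(1 - 2 * e) ^ i * approx_form i v \<le> v \<bullet> (A *\<^sub>v v) \<and>
    v \<bullet> (A *\<^sub>v v) \<le> (1 + 2 * e) ^ i * approx_form i v"
  using good
proof (induction i)
  case 0
  then show ?case by (simp add: approx_form_def)
next
  case (Suc i)
  interpret psd_mat "B i" d by (rule psd_B)
  define T where "T = (\<Sum>j<i. (\<phi> j \<bullet> (A *\<^sub>v \<phi> j)) * (\<phi> j \<bullet> v)\<^sup>2)"
  have T: "0 \<le> T"
    unfolding T_def using psd_mat.form_nonneg[OF A] by (intro sum_nonneg mult_nonneg_nonneg) auto
  define q where "q = (\<phi> i \<bullet> (A *\<^sub>v \<phi> i)) * (\<phi> i \<bullet> v)\<^sup>2 + v \<bullet> (B (Suc i) *\<^sub>v v)"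
  have \<phi>: "\<phi> i = power_method L (B i) e p (g i)" by (simp add: pca_vec_def e_def p_def)
  have d: "1 \<le> d" using ld by simp
  have "good_draw (2 * power_method_iters L d e p + 1) p (B i) (g i)"
    using Suc.prems by (simp add: t_def)
  from power_method_bound[OF g L d e_bounds(1,2) p_bounds this v, folded \<phi>, folded B_Suc]
  have step: "(1 - 2 * e) * q \<le> v \<bullet> (B i *\<^sub>v v)" "v \<bullet> (B i *\<^sub>v v) \<le> (1 + 2 * e) * q"
    by (simp_all only: q_def \<phi>_form)
  have app: "approx_form (Suc i) v = T + q" "approx_form i v = T + v \<bullet> (B i *\<^sub>v v)"
    by (simp_all add: approx_form_def T_def q_def)
  have "(1 - 2 * e) * (T + q) \<le> T + v \<bullet> (B i *\<^sub>v v)" "T + v \<bullet> (B i *\<^sub>v v) \<le> (1 + 2 * e) * (T + q)"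
    using add_relative_bounds[of "2 * e" T q "v \<bullet> (B i *\<^sub>v v)"] step T e_bounds by simp_all
  then have "(1 - 2 * e) ^ i * ((1 - 2 * e) * (T + q)) \<le> (1 - 2 * e) ^ i * (T + v \<bullet> (B i *\<^sub>v v))"
    "(1 + 2 * e) ^ i * (T + v \<bullet> (B i *\<^sub>v v)) \<le> (1 + 2 * e) ^ i * ((1 + 2 * e) * (T + q))"
    using e_bounds by (auto intro!: mult_left_mono)
  moreover have "(1 - 2 * e) ^ i * approx_form i v \<le> v \<bullet> (A *\<^sub>v v) \<and>
    v \<bullet> (A *\<^sub>v v) \<le> (1 + 2 * e) ^ i * approx_form i v"
    using Suc by simp
  ultimately show ?case unfolding app by (simp add: ac_simps)
qed

lemma pca_approx_eq:
  "pca_approx A l \<phi> =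
    mat_sum d (\<lambda>i. (\<phi> i \<bullet> (A *\<^sub>v \<phi> i)) \<cdot>\<^sub>m outer_square (\<phi> i)) {..<l} + R l * A * R l"
  using carrier_matD[OF A_carrier] by (simp add: pca_approx_def Let_def R_def)

lemma pca_approx_carrier: "pca_approx A l \<phi> \<in> carrier_mat d d"
  unfolding pca_approx_eq by (intro add_carrier_mat mult_carrier_mat[of _ d d]) auto

lemma A_transpose: "transpose_mat A = A"
  using psd_mat.psd[OF A] by (simp add: positive_semidefinite_def)

lemma pca_approx_transpose: "transpose_mat (pca_approx A l \<phi>) = pca_approx A l \<phi>"
proof -
  let ?M = "\<lambda>i. (\<phi> i \<bullet> (A *\<^sub>v \<phi> i)) \<cdot>\<^sub>m outer_square (\<phi> i)"
  have "transpose_mat (?M i) = ?M i" for i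
    using transpose_outer_square[of "\<phi> i"]
    by (simp add: transpose_smult)
  then have "transpose_mat (mat_sum d ?M {..<l}) = mat_sum d ?M {..<l}"
    by (intro transpose_mat_sum) auto
  moreover have "R l * A * R l \<in> carrier_mat d d"
    by (intro mult_carrier_mat[of _ d d]) auto
  ultimately show ?thesis
    unfolding pca_approx_eq
    using transpose_congruence[OF A_carrier A_transpose R_carrier R_transpose]
    by (simp add: transpose_add[of _ d d])
qed

lemma pca_approx_form:
  assumes v: "v \<in> carrier_vec d"
  shows "v \<bullet> (pca_approx A l \<phi> *\<^sub>v v) = approx_form l v"
proof -
  let ?M = "\<lambda>i. (\<phi> i \<bullet> (A *\<^sub>v \<phi> i)) \<cdot>\<^sub>m outer_square (\<phi> i)"
  have "v \<bullet> (?M i *\<^sub>v v) = (\<phi> i \<bullet> (A *\<^sub>v \<phi> i)) * (\<phi> i \<bullet> v)\<^sup>2" for i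
  proof -
    have "?M i *\<^sub>v v = (\<phi> i \<bullet> (A *\<^sub>v \<phi> i)) \<cdot>\<^sub>v ((\<phi> i \<bullet> v) \<cdot>\<^sub>v \<phi> i)"
      unfolding outer_square_mult_vec[OF \<phi>_carrier v, symmetric] using v
      by (intro eq_vecI) (auto simp: outer_square_def)
    then show ?thesis
      using v comm_scalar_prod[OF v \<phi>_carrier, of i] \<phi>_carrier[of i] by (simp add: power2_eq_square)
  qed
  then have M: "v \<bullet> (mat_sum d ?M {..<l} *\<^sub>v v) = (\<Sum>i<l. (\<phi> i \<bullet> (A *\<^sub>v \<phi> i)) * (\<phi> i \<bullet> v)\<^sup>2)"
    using v by (subst mat_sum_form) auto
  have RAR: "R l * A * R l \<in> carrier_mat d d"
    by (intro mult_carrier_mat[of _ d d]) auto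
  have "pca_approx A l \<phi> *\<^sub>v v = mat_sum d ?M {..<l} *\<^sub>v v + (R l * A * R l) *\<^sub>v v"
    unfolding pca_approx_eq using v RAR by (intro add_mult_distrib_mat_vec) auto
  then have "v \<bullet> (pca_approx A l \<phi> *\<^sub>v v) =
      v \<bullet> (mat_sum d ?M {..<l} *\<^sub>v v) + v \<bullet> ((R l * A * R l) *\<^sub>v v)"
    by (simp only:) (intro scalar_prod_add_distrib[OF v] mult_mat_vec_carrier[OF _ v] mat_sum_carrier RAR)
  also have "v \<bullet> ((R l * A * R l) *\<^sub>v v) = v \<bullet> (B l *\<^sub>v v)"
    unfolding B_form[OF v] by (rule congruence_form[OF A_carrier R_carrier R_transpose v])
  finally show ?thesis by (simp add: M approx_form_def)
qed

lemma loewner_bounds: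
  assumes good: "\<And>i. i < l \<Longrightarrow> good_draw (2 * t + 1) p (B i) (g i)"
  shows "(1 - \<epsilon>) ^ l \<cdot>\<^sub>m pca_approx A l \<phi> \<preceq>\<^sub>L A" "A \<preceq>\<^sub>L (1 + \<epsilon>) ^ l \<cdot>\<^sub>m pca_approx A l \<phi>"
proof -
  have smult: "c \<cdot>\<^sub>m pca_approx A l \<phi> \<in> carrier_mat d d"
    "transpose_mat (c \<cdot>\<^sub>m pca_approx A l \<phi>) = c \<cdot>\<^sub>m pca_approx A l \<phi>" for c
    using pca_approx_carrier pca_approx_transpose by (simp_all add: transpose_smult)
  have form: "v \<bullet> ((c \<cdot>\<^sub>m pca_approx A l \<phi>) *\<^sub>v v) = c * approx_form l v" if "v \<in> carrier_vec d" for c v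
  proof -
    have "(c \<cdot>\<^sub>m pca_approx A l \<phi>) *\<^sub>v v = c \<cdot>\<^sub>v (pca_approx A l \<phi> *\<^sub>v v)"
      using that pca_approx_carrier by (intro eq_vecI) auto
    then show ?thesis
      using that pca_approx_form[OF that] mult_mat_vec_carrier[OF pca_approx_carrier that] by simp
  qed
  have bounds: "(1 - \<epsilon>) ^ l * approx_form l v \<le> v \<bullet> (A *\<^sub>v v)"
    "v \<bullet> (A *\<^sub>v v) \<le> (1 + \<epsilon>) ^ l * approx_form l v" if v: "v \<in> carrier_vec d" for v
  proof -
    \<comment> \<open>Nonnegativity permits relaxing the factors \<open>1 - 2 * e\<close> and
      \<open>1 + 2 * e\<close> to \<open>1 - \<epsilon>\<close> and
      \<open>1 + \<epsilon>\<close>.\<close>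
    have "0 \<le> approx_form l v"
      unfolding approx_form_def
      using psd_mat.form_nonneg[OF A] psd_mat.form_nonneg[OF psd_B v]
      by (intro add_nonneg_nonneg sum_nonneg mult_nonneg_nonneg) auto
    then have "(1 - \<epsilon>) ^ l * approx_form l v \<le> (1 - 2 * e) ^ l * approx_form l v"
      "(1 + 2 * e) ^ l * approx_form l v \<le> (1 + \<epsilon>) ^ l * approx_form l v"
      using e_bounds \<epsilon> by (auto intro!: mult_right_mono power_mono)
    then show "(1 - \<epsilon>) ^ l * approx_form l v \<le> v \<bullet> (A *\<^sub>v v)"
      "v \<bullet> (A *\<^sub>v v) \<le> (1 + \<epsilon>) ^ l * approx_form l v"
      using approx_form_bounds[of l, OF good v] by linarith+
  qed
  show "(1 - \<epsilon>) ^ l \<cdot>\<^sub>m pca_approx A l \<phi> \<preceq>\<^sub>L A"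
    using bounds(1) by (intro loewner_leI[OF smult A_carrier A_transpose]) (simp add: form)
  show "A \<preceq>\<^sub>L (1 + \<epsilon>) ^ l \<cdot>\<^sub>m pca_approx A l \<phi>"
    using bounds(2) by (intro loewner_leI[OF A_carrier A_transpose smult]) (simp add: form)
qed

end

section \<open>Gaussian draws\<close>

abbreviation std_normal :: "real measure" where
  "std_normal \<equiv> density lborel (\<lambda>x. ennreal (std_normal_density x))"

lemma prob_space_std_normal: "prob_space std_normal"
  by (rule prob_space_normal_density) simp

lemma std_normal_density_le_1: "std_normal_density x \<le> 1"
proof -
  have "1 \<le> sqrt (2 * pi)" using pi_gt3 by simp
  then show ?thesis
    unfolding std_normal_density_def by (intro mult_le_one) (auto simp: field_simps)
qed

lemma emeasure_std_normal_interval: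
  assumes "a \<le> b"
  shows "emeasure std_normal {a..b} \<le> ennreal (b - a)"
proof -
  have "emeasure std_normal {a..b} = (\<integral>\<^sup>+x. ennreal (std_normal_density x) * indicator {a..b} x \<partial>lborel)"
    by (rule emeasure_density) auto
  also have "\<dots> \<le> (\<integral>\<^sup>+x. 1 * indicator {a..b} x \<partial>lborel)"
    using std_normal_density_le_1 by (intro nn_integral_mono mult_right_mono) auto
  also have "\<dots> = ennreal (b - a)" using assms by simp
  finally show ?thesis .
qed

text \<open>The event lies in an interval of length \<open>2 * r\<close>, and the density is at most
  1. The threshold scales with the slope, which makes the bound independent of \<open>a\<close> and
  \<open>c\<close>.\<close>

lemma emeasure_std_normal_affine:
  assumes "0 < a" "0 \<le> r"
  shows "emeasure std_normal {x. \<bar>c + a * x\<bar> < r * a} \<le> ennreal (2 * r)"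
proof -
  have "{x. \<bar>c + a * x\<bar> < r * a} \<subseteq> {- c / a - r .. - c / a + r}"
    using assms by (auto simp: abs_less_iff field_simps)
  then have "emeasure std_normal {x. \<bar>c + a * x\<bar> < r * a} \<le> emeasure std_normal {- c / a - r .. - c / a + r}"
    by (rule emeasure_mono) auto
  also have "\<dots> \<le> ennreal (- c / a + r - (- c / a - r))"
    using assms by (intro emeasure_std_normal_interval) auto
  finally show ?thesis by simp
qed

lemma nn_integral_std_normal_square: "(\<integral>\<^sup>+x. ennreal (x\<^sup>2) \<partial>std_normal) = 1"
proof -
  have "has_bochner_integral lborel (\<lambda>x. std_normal_density x * x\<^sup>2) 1"
    using std_normal_moment_even[of 1] by simp
  then have "(\<integral>\<^sup>+x. ennreal (std_normal_density x * x\<^sup>2) \<partial>lborel) = ennreal 1"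
    by (intro nn_integral_has_integral_lborel nn_integral_eq_integral[THEN trans])
      (auto simp: has_bochner_integral_iff)
  then show ?thesis
    by (simp add: nn_integral_density ennreal_mult)
qed

section \<open>Finite products: a tail bound and a small-ball bound\<close>

abbreviation normal_product :: "'i set \<Rightarrow> ('i \<Rightarrow> real) measure" where
  "normal_product J \<equiv> \<Pi>\<^sub>M j\<in>J. std_normal"

lemma prob_space_normal_product: "prob_space (normal_product J)"
  by (intro prob_space_PiM prob_space_std_normal)

interpretation normal_product: product_sigma_finite "\<lambda>_. std_normal"
  by (rule product_sigma_finite.intro)
    (intro prob_space_imp_sigma_finite prob_space_std_normal)

lemma normal_product_component[measurable]:
  "j \<in> J \<Longrightarrow> (\<lambda>\<omega>. \<omega> j) \<in> borel_measurable (normal_product J)"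
  using measurable_component_singleton[of j J "\<lambda>_. std_normal"]
  by (simp cong: measurable_cong_sets)

text \<open>Markov's inequality; the mean of the sum of squares is \<open>card J\<close>.\<close>

lemma normal_product_sum_squares_tail:
  assumes J: "finite J" and r: "0 \<le> r"
  shows "emeasure (normal_product J) {\<omega> \<in> space (normal_product J). real (card J) < r * (\<Sum>j\<in>J. (\<omega> j)\<^sup>2)}
    \<le> ennreal r"
proof (cases "J = {}")
  case True
  then show ?thesis by simp
next
  case False
  let ?M = "normal_product J"
  let ?n = "real (card J)"
  have n: "0 < ?n" using False J by (simp add: card_gt_0_iff)
  have int: "(\<integral>\<^sup>+\<omega>. ennreal ((\<omega> j)\<^sup>2) \<partial>?M) = 1" if "j \<in> J" for j
  proof -
    have "(\<integral>\<^sup>+\<omega>. ennreal ((\<omega> j)\<^sup>2) \<partial>?M) = (\<integral>\<^sup>+x. ennreal (x\<^sup>2) \<partial>distr ?M std_normal (\<lambda>\<omega>. \<omega> j))"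
      using that by (subst nn_integral_distr) auto
    also have "distr ?M std_normal (\<lambda>\<omega>. \<omega> j) = std_normal"
      using that by (intro distr_PiM_component prob_space_std_normal)
    finally show ?thesis by (simp only: nn_integral_std_normal_square)
  qed
  have "emeasure ?M {\<omega> \<in> space ?M. ?n < r * (\<Sum>j\<in>J. (\<omega> j)\<^sup>2)}
    \<le> emeasure ?M {\<omega> \<in> space ?M. 1 \<le> ennreal (r / ?n) * (\<Sum>j\<in>J. ennreal ((\<omega> j)\<^sup>2))}"
  proof (rule emeasure_mono)
    show "{\<omega> \<in> space ?M. ?n < r * (\<Sum>j\<in>J. (\<omega> j)\<^sup>2)}
      \<subseteq> {\<omega> \<in> space ?M. 1 \<le> ennreal (r / ?n) * (\<Sum>j\<in>J. ennreal ((\<omega> j)\<^sup>2))}"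
      using n r by (auto simp: sum_nonneg ennreal_mult[symmetric] field_simps)
  qed (use J in measurable)
  also have "\<dots> \<le> ennreal (r / ?n) * (\<integral>\<^sup>+\<omega>. (\<Sum>j\<in>J. ennreal ((\<omega> j)\<^sup>2)) * indicator (space ?M) \<omega> \<partial>?M)"
    by (rule nn_integral_Markov_inequality) (use J in measurable)
  also have "(\<integral>\<^sup>+\<omega>. (\<Sum>j\<in>J. ennreal ((\<omega> j)\<^sup>2)) * indicator (space ?M) \<omega> \<partial>?M)
      = (\<integral>\<^sup>+\<omega>. (\<Sum>j\<in>J. ennreal ((\<omega> j)\<^sup>2)) \<partial>?M)"
    by (intro nn_integral_cong) auto
  also have "\<dots> = ennreal ?n"
    by (subst nn_integral_sum) (auto simp: int ennreal_of_nat_eq_real_of_nat)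
  also have "ennreal (r / ?n) * ennreal ?n = ennreal r"
    using n r by (simp add: ennreal_mult[symmetric])
  finally show ?thesis .
qed

lemma normal_product_linear_small_ball:
  assumes J: "finite J" "j \<in> J" and r: "0 \<le> r"
  shows "emeasure (normal_product J) {\<omega> \<in> space (normal_product J). \<bar>\<Sum>i\<in>J. c i * \<omega> i\<bar> < r * c j}
    \<le> ennreal (2 * r)"
proof (cases "0 < c j")
  case False
  \<comment> \<open>For a nonpositive threshold the event is empty, as an absolute value is never
    below it.\<close>
  then have "r * c j \<le> 0" using r by (simp add: mult_nonneg_nonpos)
  then have "{\<omega> \<in> space (normal_product J). \<bar>\<Sum>i\<in>J. c i * \<omega> i\<bar> < r * c j} = {}"
    by (auto simp: not_less intro: order_trans)
  then show ?thesis by (simp only: emeasure_empty zero_le)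
next
  case True
  let ?I = "J - {j}"
  let ?S = "{\<omega> \<in> space (normal_product J). \<bar>\<Sum>i\<in>J. c i * \<omega> i\<bar> < r * c j}"
  have ins: "insert j ?I = J" using J by auto
  have meas: "?S \<in> sets (normal_product J)" by measurable
  interpret I: prob_space "normal_product ?I" by (rule prob_space_normal_product)
  have "emeasure (normal_product J) ?S = (\<integral>\<^sup>+\<omega>. indicator ?S \<omega> \<partial>normal_product (insert j ?I))"
    unfolding ins by (rule nn_integral_indicator[OF meas, symmetric])
  also have "\<dots> = (\<integral>\<^sup>+x. \<integral>\<^sup>+y. indicator ?S (x(j := y)) \<partial>std_normal \<partial>normal_product ?I)"
  proof (rule normal_product.product_nn_integral_insert)
    show "indicator ?S \<in> borel_measurable (normal_product (insert j ?I))"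
      unfolding ins using meas by (rule borel_measurable_indicator)
  qed (use J in auto)
  also have "\<dots> \<le> (\<integral>\<^sup>+x. ennreal (2 * r) \<partial>normal_product ?I)"
  proof (rule nn_integral_mono)
    fix x
    let ?b = "\<Sum>i\<in>?I. c i * x i"
    let ?T = "{y. \<bar>?b + c j * y\<bar> < r * c j}"
    have "(\<Sum>i\<in>J. c i * (x(j := y)) i) = ?b + c j * y" for y
      using J by (subst sum.remove[of _ j]) (auto intro!: sum.cong)
    then have "indicator ?S (x(j := y)) \<le> (indicator ?T y :: ennreal)" for y
      by (auto simp: indicator_def)
    then have "(\<integral>\<^sup>+y. indicator ?S (x(j := y)) \<partial>std_normal) \<le> (\<integral>\<^sup>+y. indicator ?T y \<partial>std_normal)"
      by (intro nn_integral_mono)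
    also have "\<dots> = emeasure std_normal ?T" by (rule nn_integral_indicator) simp
    also have "\<dots> \<le> ennreal (2 * r)" using True r by (rule emeasure_std_normal_affine)
    finally show "(\<integral>\<^sup>+y. indicator ?S (x(j := y)) \<partial>std_normal) \<le> ennreal (2 * r)" .
  qed
  also have "\<dots> = ennreal (2 * r)" using I.emeasure_space_1 by simp
  finally show ?thesis .
qed

text \<open>For fixed \<open>B\<close> the index \<open>j\<close> of the largest diagonal entry of
  \<open>B ^\<^sub>m k\<close> is fixed. A bad draw either has a large norm or has a small
  coordinate \<open>j\<close> of the image, a linear form in which variable \<open>j\<close> has
  this largest entry as coefficient.\<close>

lemma (in psd_mat) bad_draw_prob:
  fixes i :: 'i
  assumes d: "1 \<le> d" and p: "0 \<le> p"
  defines "M \<equiv> normal_product ({i} \<times> {..<d})"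
  assumes meas: "{y \<in> space M. \<not> good_draw k p B (vec d (\<lambda>j. y (i, j)))} \<in> sets M"
  shows "emeasure M {y \<in> space M. \<not> good_draw k p B (vec d (\<lambda>j. y (i, j)))} \<le> ennreal (2 * p)"
proof -
  let ?J = "{i} \<times> {..<d}"
  have J: "finite ?J" "card ?J = d" by (simp_all add: card_cartesian_product)
  have dim: "dim_row B = d" using carrier by simp
  have C: "B ^\<^sub>m k \<in> carrier_mat d d" using carrier by simp
  define c where "c m n = (B ^\<^sub>m k) $$ (m, n)" for m n
  let ?V = "(\<lambda>m. c m m) ` {..<d}"
  have "Max ?V \<in> ?V" using d by (intro Max_in) (auto simp: lessThan_empty_iff)
  then obtain j where j: "j < d" and "Max ?V = c j j" by auto
  then have max: "c m m \<le> c j j" if "m < d" for m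
    using that Max_ge[of ?V "c m m"] by auto
  have sum_J: "(\<Sum>m\<in>?J. f m) = (\<Sum>m<d. f (i, m))" for f :: "'i \<times> nat \<Rightarrow> real"
  proof -
    have "?J = Pair i ` {..<d}" by auto
    then show ?thesis by (simp add: sum.reindex inj_on_def)
  qed
  let ?S1 = "{y \<in> space M. real (card ?J) < p * (\<Sum>m\<in>?J. (y m)\<^sup>2)}"
  let ?S2 = "{y \<in> space M. \<bar>\<Sum>m\<in>?J. c j (snd m) * y m\<bar> < p / 2 * c j (snd (i, j))}"
  have "{y \<in> space M. \<not> good_draw k p B (vec d (\<lambda>j. y (i, j)))} \<subseteq> ?S1 \<union> ?S2"
  proof (rule subsetI, rule ccontr)
    fix y
    assume y: "y \<in> {y \<in> space M. \<not> good_draw k p B (vec d (\<lambda>j. y (i, j)))}" and "y \<notin> ?S1 \<union> ?S2"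
    then have s1: "p * (\<Sum>m<d. (y (i, m))\<^sup>2) \<le> real d"
      and s2: "p / 2 * c j j \<le> \<bar>\<Sum>m<d. c j m * y (i, m)\<bar>"
      unfolding sum_J J by (auto simp: not_less)
    let ?g = "vec d (\<lambda>j. y (i, j))"
    have "?g \<bullet> ?g = (\<Sum>m<d. (y (i, m))\<^sup>2)"
      by (simp add: scalar_prod_def lessThan_atLeast0 power2_eq_square)
    moreover have "((B ^\<^sub>m k) *\<^sub>v ?g) $ j = (\<Sum>m<d. c j m * y (i, m))"
      using C j by (subst index_mult_mat_vec) (auto simp: scalar_prod_def lessThan_atLeast0 c_def simp del: pow_mat_dim)
    ultimately have "good_draw k p B ?g"
      unfolding good_draw_def dim using s1 s2 j max by (auto simp: c_def)
    with y show False by simp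
  qed
  moreover have "?S1 \<in> sets M" "?S2 \<in> sets M" unfolding M_def by measurable
  ultimately have "emeasure M {y \<in> space M. \<not> good_draw k p B (vec d (\<lambda>j. y (i, j)))}
      \<le> emeasure M ?S1 + emeasure M ?S2"
    by (meson emeasure_mono emeasure_subadditive order_trans sets.Un)
  \<comment> \<open>The small-ball bound doubles its radius, so the factor \<open>p / 2\<close> in
    \<open>good_draw\<close> makes both parts cost \<open>p\<close>.\<close>
  also have "\<dots> \<le> ennreal p + ennreal (2 * (p / 2))"
    unfolding M_def using J j p
    by (intro add_mono normal_product_sum_squares_tail normal_product_linear_small_ball) auto
  also have "\<dots> = ennreal (2 * p)" using p by (simp add: ennreal_plus[symmetric] del: ennreal_plus)
  finally show ?thesis .
qed

section \<open>Measurability\<close>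

text \<open>Measurability is entrywise; the dimension is fixed at every \<open>\<omega>\<close>, so
  that the index ranges of products and sums do not depend on \<open>\<omega>\<close>.\<close>

definition mat_measurable :: "nat \<Rightarrow> 'w measure \<Rightarrow> ('w \<Rightarrow> real mat) \<Rightarrow> bool" where
  "mat_measurable d M F \<longleftrightarrow> (\<forall>\<omega>. F \<omega> \<in> carrier_mat d d) \<and>
     (\<forall>i<d. \<forall>j<d. (\<lambda>\<omega>. F \<omega> $$ (i, j)) \<in> borel_measurable M)"

definition vec_measurable :: "nat \<Rightarrow> 'w measure \<Rightarrow> ('w \<Rightarrow> real vec) \<Rightarrow> bool" where
  "vec_measurable d M f \<longleftrightarrow> (\<forall>\<omega>. f \<omega> \<in> carrier_vec d) \<and>
     (\<forall>i<d. (\<lambda>\<omega>. f \<omega> $ i) \<in> borel_measurable M)"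

lemma mat_measurableD:
  assumes "mat_measurable d M F"
  shows "F \<omega> \<in> carrier_mat d d" "dim_row (F \<omega>) = d" "dim_col (F \<omega>) = d"
    "i < d \<Longrightarrow> j < d \<Longrightarrow> (\<lambda>\<omega>. F \<omega> $$ (i, j)) \<in> borel_measurable M"
proof -
  show F: "F \<omega> \<in> carrier_mat d d" using assms[unfolded mat_measurable_def, THEN conjunct1] by (rule spec)
  show "dim_row (F \<omega>) = d" "dim_col (F \<omega>) = d" using carrier_matD[OF F] by simp_all
  show "i < d \<Longrightarrow> j < d \<Longrightarrow> (\<lambda>\<omega>. F \<omega> $$ (i, j)) \<in> borel_measurable M"
    by (rule assms[unfolded mat_measurable_def, THEN conjunct2, rule_format])
qed

lemma vec_measurableD:
  assumes "vec_measurable d M f"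
  shows "f \<omega> \<in> carrier_vec d" "dim_vec (f \<omega>) = d"
    "i < d \<Longrightarrow> (\<lambda>\<omega>. f \<omega> $ i) \<in> borel_measurable M"
proof -
  show f: "f \<omega> \<in> carrier_vec d" using assms[unfolded vec_measurable_def, THEN conjunct1] by (rule spec)
  show "dim_vec (f \<omega>) = d" using carrier_vecD[OF f] by simp
  show "i < d \<Longrightarrow> (\<lambda>\<omega>. f \<omega> $ i) \<in> borel_measurable M"
    by (rule assms[unfolded vec_measurable_def, THEN conjunct2, rule_format])
qed

lemma mat_measurableI:
  assumes "\<And>\<omega>. F \<omega> \<in> carrier_mat d d"
    and "\<And>i j. i < d \<Longrightarrow> j < d \<Longrightarrow> (\<lambda>\<omega>. F \<omega> $$ (i, j)) \<in> borel_measurable M"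
  shows "mat_measurable d M F"
  unfolding mat_measurable_def by (intro conjI allI impI assms)

lemma vec_measurableI:
  assumes "\<And>\<omega>. f \<omega> \<in> carrier_vec d"
    and "\<And>i. i < d \<Longrightarrow> (\<lambda>\<omega>. f \<omega> $ i) \<in> borel_measurable M"
  shows "vec_measurable d M f"
  unfolding vec_measurable_def by (intro conjI allI impI assms)

lemma mat_measurable_const: "A \<in> carrier_mat d d \<Longrightarrow> mat_measurable d M (\<lambda>_. A)"
  by (rule mat_measurableI) simp_all

lemma mat_measurable_mult:
  assumes F: "mat_measurable d M F" and G: "mat_measurable d M G"
  shows "mat_measurable d M (\<lambda>\<omega>. F \<omega> * G \<omega>)"
proof (rule mat_measurableI)
  show "F \<omega> * G \<omega> \<in> carrier_mat d d" for \<omega>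
    using mat_measurableD(1)[OF F] mat_measurableD(1)[OF G] by (rule mult_carrier_mat)
  fix i j assume ij: "i < d" "j < d"
  have "(\<lambda>\<omega>. (F \<omega> * G \<omega>) $$ (i, j)) = (\<lambda>\<omega>. \<Sum>k\<in>{0..<d}. F \<omega> $$ (i, k) * G \<omega> $$ (k, j))"
    using ij by (simp add: scalar_prod_def mat_measurableD(2,3)[OF F] mat_measurableD(2,3)[OF G])
  moreover have "(\<lambda>\<omega>. \<Sum>k\<in>{0..<d}. F \<omega> $$ (i, k) * G \<omega> $$ (k, j)) \<in> borel_measurable M"
    by (rule borel_measurable_sum,
        rule borel_measurable_times[OF mat_measurableD(4)[OF F] mat_measurableD(4)[OF G]])
      (use ij in simp_all)
  ultimately show "(\<lambda>\<omega>. (F \<omega> * G \<omega>) $$ (i, j)) \<in> borel_measurable M" by (simp only:)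
qed

lemma mat_measurable_add:
  assumes F: "mat_measurable d M F" and G: "mat_measurable d M G"
  shows "mat_measurable d M (\<lambda>\<omega>. F \<omega> + G \<omega>)"
proof (rule mat_measurableI)
  show "F \<omega> + G \<omega> \<in> carrier_mat d d" for \<omega>
    using mat_measurableD(1)[OF G] by (rule add_carrier_mat)
  fix i j assume ij: "i < d" "j < d"
  have "(\<lambda>\<omega>. (F \<omega> + G \<omega>) $$ (i, j)) = (\<lambda>\<omega>. F \<omega> $$ (i, j) + G \<omega> $$ (i, j))"
    using ij by (simp add: mat_measurableD(2,3)[OF G])
  with borel_measurable_add[OF mat_measurableD(4)[OF F ij] mat_measurableD(4)[OF G ij]]
  show "(\<lambda>\<omega>. (F \<omega> + G \<omega>) $$ (i, j)) \<in> borel_measurable M" by (simp only:)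
qed

lemma mat_measurable_diff:
  assumes F: "mat_measurable d M F" and G: "mat_measurable d M G"
  shows "mat_measurable d M (\<lambda>\<omega>. F \<omega> - G \<omega>)"
proof (rule mat_measurableI)
  show "F \<omega> - G \<omega> \<in> carrier_mat d d" for \<omega>
    using mat_measurableD(1)[OF G] by (rule minus_carrier_mat)
  fix i j assume ij: "i < d" "j < d"
  have "(\<lambda>\<omega>. (F \<omega> - G \<omega>) $$ (i, j)) = (\<lambda>\<omega>. F \<omega> $$ (i, j) - G \<omega> $$ (i, j))"
    using ij by (simp add: mat_measurableD(2,3)[OF G])
  with borel_measurable_diff[OF mat_measurableD(4)[OF F ij] mat_measurableD(4)[OF G ij]]
  show "(\<lambda>\<omega>. (F \<omega> - G \<omega>) $$ (i, j)) \<in> borel_measurable M" by (simp only:)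
qed

lemma mat_measurable_smult:
  assumes c: "c \<in> borel_measurable M" and G: "mat_measurable d M G"
  shows "mat_measurable d M (\<lambda>\<omega>. c \<omega> \<cdot>\<^sub>m G \<omega>)"
proof (rule mat_measurableI)
  show "c \<omega> \<cdot>\<^sub>m G \<omega> \<in> carrier_mat d d" for \<omega>
    using mat_measurableD(1)[OF G] by (rule smult_carrier_mat)
  fix i j assume ij: "i < d" "j < d"
  have "(\<lambda>\<omega>. (c \<omega> \<cdot>\<^sub>m G \<omega>) $$ (i, j)) = (\<lambda>\<omega>. c \<omega> * G \<omega> $$ (i, j))"
    using ij by (simp add: mat_measurableD(2,3)[OF G])
  with borel_measurable_times[OF c mat_measurableD(4)[OF G ij]]
  show "(\<lambda>\<omega>. (c \<omega> \<cdot>\<^sub>m G \<omega>) $$ (i, j)) \<in> borel_measurable M" by (simp only:)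
qed

lemma mat_measurable_sum:
  assumes F: "\<And>i. i \<in> I \<Longrightarrow> mat_measurable d M (F i)"
  shows "mat_measurable d M (\<lambda>\<omega>. mat_sum d (\<lambda>i. F i \<omega>) I)"
proof (rule mat_measurableI)
  fix i j assume ij: "i < d" "j < d"
  have "(\<lambda>\<omega>. mat_sum d (\<lambda>i. F i \<omega>) I $$ (i, j)) = (\<lambda>\<omega>. \<Sum>k\<in>I. F k \<omega> $$ (i, j))"
    using ij by (simp add: mat_sum_def)
  moreover have "(\<lambda>\<omega>. \<Sum>k\<in>I. F k \<omega> $$ (i, j)) \<in> borel_measurable M"
    by (rule borel_measurable_sum, rule mat_measurableD(4)[OF F ij])
  ultimately show "(\<lambda>\<omega>. mat_sum d (\<lambda>i. F i \<omega>) I $$ (i, j)) \<in> borel_measurable M"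
    by (simp only:)
qed simp

lemma mat_measurable_pow:
  assumes F: "mat_measurable d M F"
  shows "mat_measurable d M (\<lambda>\<omega>. F \<omega> ^\<^sub>m k)"
proof (induction k)
  case 0
  then show ?case using mat_measurable_const[of "1\<^sub>m d" d M] by (simp add: mat_measurableD(2)[OF F])
next
  case (Suc k)
  then show ?case using mat_measurable_mult[OF Suc F] by simp
qed

lemma mat_measurable_outer_square:
  assumes f: "vec_measurable d M f"
  shows "mat_measurable d M (\<lambda>\<omega>. outer_square (f \<omega>))"
proof (rule mat_measurableI)
  show "outer_square (f \<omega>) \<in> carrier_mat d d" for \<omega>
    using vec_measurableD(1)[OF f] by (rule outer_square_carrier)
  fix i j assume ij: "i < d" "j < d"
  have "(\<lambda>\<omega>. outer_square (f \<omega>) $$ (i, j)) = (\<lambda>\<omega>. f \<omega> $ i * f \<omega> $ j)"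
    using ij by (simp add: outer_square_def vec_measurableD(2)[OF f])
  with borel_measurable_times[OF vec_measurableD(3)[OF f ij(1)] vec_measurableD(3)[OF f ij(2)]]
  show "(\<lambda>\<omega>. outer_square (f \<omega>) $$ (i, j)) \<in> borel_measurable M" by (simp only:)
qed

lemma vec_measurable_mult:
  assumes F: "mat_measurable d M F" and f: "vec_measurable d M f"
  shows "vec_measurable d M (\<lambda>\<omega>. F \<omega> *\<^sub>v f \<omega>)"
proof (rule vec_measurableI)
  show "F \<omega> *\<^sub>v f \<omega> \<in> carrier_vec d" for \<omega>
    using mat_measurableD(1)[OF F] vec_measurableD(1)[OF f] by (rule mult_mat_vec_carrier)
  fix i assume i: "i < d"
  have "(\<lambda>\<omega>. (F \<omega> *\<^sub>v f \<omega>) $ i) = (\<lambda>\<omega>. \<Sum>k\<in>{0..<d}. F \<omega> $$ (i, k) * f \<omega> $ k)"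
    using i by (simp add: scalar_prod_def mat_measurableD(2,3)[OF F] vec_measurableD(2)[OF f])
  moreover have "(\<lambda>\<omega>. \<Sum>k\<in>{0..<d}. F \<omega> $$ (i, k) * f \<omega> $ k) \<in> borel_measurable M"
    by (rule borel_measurable_sum,
        rule borel_measurable_times[OF mat_measurableD(4)[OF F] vec_measurableD(3)[OF f]])
      (use i in simp_all)
  ultimately show "(\<lambda>\<omega>. (F \<omega> *\<^sub>v f \<omega>) $ i) \<in> borel_measurable M" by (simp only:)
qed

lemma vec_measurable_smult:
  assumes c: "c \<in> borel_measurable M" and f: "vec_measurable d M f"
  shows "vec_measurable d M (\<lambda>\<omega>. c \<omega> \<cdot>\<^sub>v f \<omega>)"
proof (rule vec_measurableI)
  show "c \<omega> \<cdot>\<^sub>v f \<omega> \<in> carrier_vec d" for \<omega>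
    using vec_measurableD(1)[OF f] by simp
  fix i assume i: "i < d"
  have "(\<lambda>\<omega>. (c \<omega> \<cdot>\<^sub>v f \<omega>) $ i) = (\<lambda>\<omega>. c \<omega> * f \<omega> $ i)"
    using i by (simp add: vec_measurableD(2)[OF f])
  with borel_measurable_times[OF c vec_measurableD(3)[OF f i]]
  show "(\<lambda>\<omega>. (c \<omega> \<cdot>\<^sub>v f \<omega>) $ i) \<in> borel_measurable M" by (simp only:)
qed

lemma scalar_prod_measurable:
  assumes f: "vec_measurable d M f" and h: "vec_measurable d M h"
  shows "(\<lambda>\<omega>. f \<omega> \<bullet> h \<omega>) \<in> borel_measurable M"
  unfolding scalar_prod_def vec_measurableD(2)[OF h]
  by (rule borel_measurable_sum,
      rule borel_measurable_times[OF vec_measurableD(3)[OF f] vec_measurableD(3)[OF h]]) simp_all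

section \<open>Measurability of a power iteration and of its success\<close>

lemma power_method_measurable:
  assumes F: "mat_measurable d M F" and f: "vec_measurable d M f"
  shows "vec_measurable d M (\<lambda>\<omega>. power_method L (F \<omega>) e p (f \<omega>))"
proof -
  have x: "vec_measurable d M (\<lambda>\<omega>. (F \<omega> ^\<^sub>m power_method_iters L d e p) *\<^sub>v f \<omega>)"
    by (rule vec_measurable_mult[OF mat_measurable_pow[OF F] f])
  show ?thesis
    unfolding power_method_def Let_def mat_measurableD(2)[OF F] vec_norm2_def
    by (rule vec_measurable_smult[OF borel_measurable_divide[OF borel_measurable_const
          measurable_compose[OF scalar_prod_measurable[OF x x] borel_measurable_sqrt]] x])
qed

lemma
  fixes f g :: "'w \<Rightarrow> real"
  assumes "f \<in> borel_measurable M" "g \<in> borel_measurable M"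
  shows borel_measurable_pred_le: "Measurable.pred M (\<lambda>w. f w \<le> g w)"
    and borel_measurable_pred_eq: "Measurable.pred M (\<lambda>w. f w = g w)"
  unfolding Measurable.pred_def
  by (rule borel_measurable_le[OF assms], rule borel_measurable_eq[OF assms])

lemma good_draw_measurable:
  assumes F: "mat_measurable d M F" and f: "vec_measurable d M f"
  shows "Measurable.pred M (\<lambda>\<omega>. good_draw k p (F \<omega>) (f \<omega>))"
proof -
  note C = mat_measurable_pow[OF F, of k]
  have norm: "Measurable.pred M (\<lambda>\<omega>. p * (f \<omega> \<bullet> f \<omega>) \<le> real d)"
    by (rule borel_measurable_pred_le[OF borel_measurable_times[OF borel_measurable_const
            scalar_prod_measurable[OF f f]] borel_measurable_const])
  have diag: "Measurable.pred M (\<lambda>\<omega>. (F \<omega> ^\<^sub>m k) $$ (i, i) \<le> (F \<omega> ^\<^sub>m k) $$ (j, j))"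
    if "i \<in> {..<d}" "j \<in> {..<d}" for i j
    using that by (intro borel_measurable_pred_le[OF mat_measurableD(4)[OF C] mat_measurableD(4)[OF C]]) auto
  have coord: "Measurable.pred M (\<lambda>\<omega>. p / 2 * (F \<omega> ^\<^sub>m k) $$ (j, j) \<le> \<bar>((F \<omega> ^\<^sub>m k) *\<^sub>v f \<omega>) $ j\<bar>)"
    if "j \<in> {..<d}" for j
    using that
    by (intro borel_measurable_pred_le[OF borel_measurable_times[OF borel_measurable_const
            mat_measurableD(4)[OF C]] borel_measurable_abs[OF vec_measurableD(3)[OF vec_measurable_mult[OF C f]]]])
      auto
  have *: "(\<exists>j<d. (\<forall>i<d. Q i j) \<and> S j) \<longleftrightarrow> (\<exists>j\<in>{..<d}. (\<forall>i\<in>{..<d}. Q i j) \<and> S j)" for Q S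
    by auto
  show ?thesis
    unfolding good_draw_def mat_measurableD(2)[OF F] *
    by (intro pred_intros_logic pred_intros_finite finite_lessThan norm diag coord)
qed

section \<open>Measurability of the Loewner order\<close>

text \<open>Turns the quantifier over real vectors into a countable one. Rational vectors are dense,
  and homogeneity of the form clears denominators, so integer vectors suffice. Lists give a
  countable type independent of \<open>d\<close>; a list of any length supplies some integer at each
  index below \<open>d\<close>.\<close>

lemma psd_iff_integer_vectors:
  assumes A: "A \<in> carrier_mat d d"
  shows "positive_semidefinite A \<longleftrightarrow>
    (\<forall>i\<in>{..<d}. \<forall>j\<in>{..<d}. A $$ (j, i) = A $$ (i, j)) \<and>
    (\<forall>z :: int list.
      0 \<le> (\<Sum>i<d. \<Sum>j<d. real_of_int (z ! i) * A $$ (i, j) * real_of_int (z ! j)))"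
proof -
  note form = form_eq_sum[OF A]
  have sym: "transpose_mat A = A \<longleftrightarrow> (\<forall>i\<in>{..<d}. \<forall>j\<in>{..<d}. A $$ (j, i) = A $$ (i, j))"
  proof
    assume "transpose_mat A = A"
    then have "A $$ (j, i) = A $$ (i, j)" if "i < d" "j < d" for i j
      using index_transpose_mat(1)[of i A j] that A by simp
    then show "\<forall>i\<in>{..<d}. \<forall>j\<in>{..<d}. A $$ (j, i) = A $$ (i, j)" by auto
  next
    assume "\<forall>i\<in>{..<d}. \<forall>j\<in>{..<d}. A $$ (j, i) = A $$ (i, j)"
    then show "transpose_mat A = A" using A by (intro eq_matI) auto
  qed
  have "(\<forall>v\<in>carrier_vec d. 0 \<le> v \<bullet> (A *\<^sub>v v)) \<longleftrightarrow>
    (\<forall>z :: int list.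
      0 \<le> (\<Sum>i<d. \<Sum>j<d. real_of_int (z ! i) * A $$ (i, j) * real_of_int (z ! j)))" (is "?V \<longleftrightarrow> ?Z")
  proof
    assume ?V
    show ?Z
    proof
      fix z :: "int list"
      define v where "v = vec d (\<lambda>i. real_of_int (z ! i))"
      have v: "v \<in> carrier_vec d" by (simp add: v_def)
      have "0 \<le> (\<Sum>i<d. \<Sum>j<d. v $ i * A $$ (i, j) * v $ j)"
        using \<open>?V\<close> v form[OF v] by metis
      then show "0 \<le> (\<Sum>i<d. \<Sum>j<d. real_of_int (z ! i) * A $$ (i, j) * real_of_int (z ! j))"
        by (simp add: v_def)
    qed
  next
    assume Z: ?Z
    show ?V
    proof
      fix v :: "real vec" assume v: "v \<in> carrier_vec d"
      \<comment> \<open>\<open>z n\<close> divided by \<open>n\<close> tends to \<open>v\<close>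
        entrywise.\<close>
      define z where "z n = map (\<lambda>i. \<lfloor>real n * v $ i\<rfloor>) [0..<d]" for n
      have "(\<lambda>n. real_of_int \<lfloor>real n * x\<rfloor> / real n) \<longlonglongrightarrow> x" for x :: real
      proof (rule real_tendsto_sandwich)
        have "real n * x - 1 \<le> real_of_int \<lfloor>real n * x\<rfloor>" for n by linarith
        then have "(real n * x - 1) / real n \<le> real_of_int \<lfloor>real n * x\<rfloor> / real n" for n
          by (intro divide_right_mono) auto
        then show "\<forall>\<^sub>F n in sequentially. (real n * x - 1) / real n \<le> real_of_int \<lfloor>real n * x\<rfloor> / real n"
          by simp
        have "real_of_int \<lfloor>real n * x\<rfloor> / real n \<le> real n * x / real n" for n
          by (intro divide_right_mono) auto
        then show "\<forall>\<^sub>F n in sequentially. real_of_int \<lfloor>real n * x\<rfloor> / real n \<le> real n * x / real n"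
          by simp
      qed real_asymp+
      then have "(\<lambda>n. \<Sum>i<d. \<Sum>j<d. real_of_int (z n ! i) / real n * A $$ (i, j) * (real_of_int (z n ! j) / real n))
        \<longlonglongrightarrow> (\<Sum>i<d. \<Sum>j<d. v $ i * A $$ (i, j) * v $ j)"
        by (intro tendsto_sum tendsto_mult tendsto_const) (simp_all add: z_def)
      moreover have "0 \<le> (\<Sum>i<d. \<Sum>j<d. real_of_int (z n ! i) / real n * A $$ (i, j) * (real_of_int (z n ! j) / real n))" for n
      proof -
        \<comment> \<open>The scaled form is the integer form over \<open>n\<^sup>2\<close>; for
          \<open>n = 0\<close> both are 0 by division by zero.\<close>
        have "0 \<le> (\<Sum>i<d. \<Sum>j<d. real_of_int (z n ! i) * A $$ (i, j) * real_of_int (z n ! j)) / (real n * real n)"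
          using Z by (intro divide_nonneg_nonneg) auto
        then show ?thesis by (simp add: sum_divide_distrib)
      qed
      ultimately show "0 \<le> v \<bullet> (A *\<^sub>v v)"
        unfolding form[OF v] by (intro LIMSEQ_le_const) auto
    qed
  qed
  then show ?thesis
    using A sym unfolding positive_semidefinite_def by (auto simp: square_mat.simps)
qed

lemma psd_measurable:
  assumes F: "mat_measurable d M F"
  shows "Measurable.pred M (\<lambda>\<omega>. positive_semidefinite (F \<omega>))"
proof -
  have "Measurable.pred M (\<lambda>\<omega>. F \<omega> $$ (j, i) = F \<omega> $$ (i, j))"
    if "i \<in> {..<d}" "j \<in> {..<d}" for i j
    using that by (intro borel_measurable_pred_eq mat_measurableD(4)[OF F]) auto
  moreover have "Measurable.pred M (\<lambda>\<omega>. 0 \<le> (\<Sum>i<d. \<Sum>j<d.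
      real_of_int (z ! i) * F \<omega> $$ (i, j) * real_of_int (z ! j)))" for z
    by (intro borel_measurable_pred_le borel_measurable_const borel_measurable_sum
        borel_measurable_times[OF borel_measurable_times[OF _ mat_measurableD(4)[OF F]]]) auto
  ultimately show ?thesis
    unfolding psd_iff_integer_vectors[OF mat_measurableD(1)[OF F]]
    by (intro pred_intros_logic pred_intros_finite pred_intros_countable finite_lessThan)
qed

lemma loewner_le_measurable:
  assumes F: "mat_measurable d M F" and G: "mat_measurable d M G"
  shows "Measurable.pred M (\<lambda>\<omega>. F \<omega> \<preceq>\<^sub>L G \<omega>)"
  unfolding loewner_le_def mat_measurableD(2,3)[OF F] mat_measurableD(2,3)[OF G]
  by (simp only: simp_thms) (rule psd_measurable[OF mat_measurable_diff[OF G F]])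

section \<open>Probability bound\<close>

lemma pca_mat_cong:
  "(\<And>j. j < i \<Longrightarrow> g j = h j) \<Longrightarrow> pca_mat L A l \<epsilon> \<delta> g i = pca_mat L A l \<epsilon> \<delta> h i"
  by (induction i) simp_all

lemma pca_mat_measurable:
  assumes A: "A \<in> carrier_mat d d" and g: "\<And>j. j < i \<Longrightarrow> vec_measurable d M (\<lambda>\<omega>. g \<omega> j)"
  shows "mat_measurable d M (\<lambda>\<omega>. pca_mat L A l \<epsilon> \<delta> (g \<omega>) i)"
  using g
proof (induction i)
  case 0
  then show ?case using mat_measurable_const[OF A] by simp
next
  case (Suc i)
  then have B: "mat_measurable d M (\<lambda>\<omega>. pca_mat L A l \<epsilon> \<delta> (g \<omega>) i)" by simp
  note P = mat_measurable_diff[OF mat_measurable_const[OF one_carrier_mat]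
      mat_measurable_outer_square[OF power_method_measurable[OF B Suc.prems[OF lessI]]]]
  show ?case
    unfolding pca_mat.simps Let_def carrier_matD(1)[OF A]
    by (rule mat_measurable_mult[OF mat_measurable_mult[OF P B] P])
qed

lemma pca_vec_measurable:
  assumes A: "A \<in> carrier_mat d d" and g: "\<And>j. j \<le> i \<Longrightarrow> vec_measurable d M (\<lambda>\<omega>. g \<omega> j)"
  shows "vec_measurable d M (\<lambda>\<omega>. pca_vec L A l \<epsilon> \<delta> (g \<omega>) i)"
  unfolding pca_vec_def
  by (rule power_method_measurable[OF pca_mat_measurable[OF A g] g]) simp_all

lemma pca_approx_measurable:
  assumes A: "A \<in> carrier_mat d d" and \<phi>: "\<And>i. i < l \<Longrightarrow> vec_measurable d M (\<lambda>\<omega>. \<phi> \<omega> i)"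
  shows "mat_measurable d M (\<lambda>\<omega>. pca_approx A l (\<phi> \<omega>))"
proof -
  note A' = mat_measurable_const[OF A]
  have S: "mat_measurable d M (\<lambda>\<omega>. mat_sum d (\<lambda>i. outer_square (\<phi> \<omega> i)) {..<l})"
    by (rule mat_measurable_sum) (auto intro: mat_measurable_outer_square \<phi>)
  note R = mat_measurable_diff[OF mat_measurable_const[OF one_carrier_mat] S]
  have "mat_measurable d M (\<lambda>\<omega>. (\<phi> \<omega> i \<bullet> (A *\<^sub>v \<phi> \<omega> i)) \<cdot>\<^sub>m outer_square (\<phi> \<omega> i))" if "i \<in> {..<l}" for i
    using that
    by (intro mat_measurable_smult scalar_prod_measurable[OF \<phi> vec_measurable_mult[OF A' \<phi>]]
        mat_measurable_outer_square \<phi>) simp_all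
  then show ?thesis
    unfolding pca_approx_def Let_def carrier_matD(1)[OF A]
    by (rule mat_measurable_add[OF mat_measurable_sum mat_measurable_mult[OF mat_measurable_mult[OF R A'] R]])
qed

lemma coordinates_measurable:
  assumes "\<And>j. j < d \<Longrightarrow> (i, j) \<in> J"
  shows "vec_measurable d (normal_product J) (\<lambda>y. vec d (\<lambda>j. y (i, j)))"
proof (rule vec_measurableI)
  show "vec d (\<lambda>j. y (i, j)) \<in> carrier_vec d" for y :: "'a \<times> nat \<Rightarrow> real"
    by (rule vec_carrier)
  fix j assume j: "j < d"
  have "(\<lambda>y. vec d (\<lambda>j. y (i, j)) $ j) = (\<lambda>y. y (i, j) :: real)" using j by simp
  with normal_product_component[OF assms[OF j]]
  show "(\<lambda>y. vec d (\<lambda>j. y (i, j)) $ j) \<in> borel_measurable (normal_product J)" by (simp only:)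
qed

lemma draw_vec_measurable:
  "i < l \<Longrightarrow> vec_measurable d (gaussian_draws l d) (\<lambda>\<omega>. draw_vec d \<omega> i)"
  unfolding gaussian_draws_def draw_vec_def by (rule coordinates_measurable) simp

text \<open>
  The matrix \<open>A\<^sub>i\<close> is a function of the draws before \<open>i\<close>, so that conditionally on all draws other
  than number \<open>i\<close> the bound for a fixed matrix applies.
\<close>

lemma bad_step_prob:
  fixes d l k :: nat
  assumes A: "psd_mat A d" and i: "i < l" and ld: "1 \<le> l" "l \<le> d" and L: "12 \<le> L"
    and \<epsilon>: "0 < \<epsilon>" "\<epsilon> \<le> 1" and \<delta>: "0 < \<delta>" "\<delta> \<le> 1" and p: "0 \<le> p"
  defines "M \<equiv> gaussian_draws l d"
  defines "bad \<equiv> {\<omega> \<in> space M. \<not> good_draw k p (pca_mat L A l \<epsilon> \<delta> (draw_vec d \<omega>) i) (draw_vec d \<omega> i)}"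
  shows "bad \<in> sets M" "emeasure M bad \<le> ennreal (2 * p)"
proof -
  have A_carrier: "A \<in> carrier_mat d d" using A by (rule psd_mat.carrier)
  have "Measurable.pred M (\<lambda>\<omega>. good_draw k p (pca_mat L A l \<epsilon> \<delta> (draw_vec d \<omega>) i) (draw_vec d \<omega> i))"
    unfolding M_def using i
    by (intro good_draw_measurable[where d = d] pca_mat_measurable[OF A_carrier] draw_vec_measurable) auto
  then have "Measurable.pred M (\<lambda>\<omega>. \<not> good_draw k p (pca_mat L A l \<epsilon> \<delta> (draw_vec d \<omega>) i) (draw_vec d \<omega> i))"
    by (rule pred_intros_logic)
  then show bad: "bad \<in> sets M" unfolding bad_def Measurable.pred_def .
  let ?J = "{i} \<times> {..<d}"
  let ?I = "{..<l} \<times> {..<d} - ?J"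
  have M: "M = normal_product (?I \<union> ?J)"
    unfolding M_def gaussian_draws_def using i by (intro arg_cong2[where f = PiM]) auto
  interpret I: prob_space "normal_product ?I" by (rule prob_space_normal_product)
  have "emeasure M bad = (\<integral>\<^sup>+\<omega>. indicator bad \<omega> \<partial>M)"
    by (rule nn_integral_indicator[OF bad, symmetric])
  also have "\<dots> = (\<integral>\<^sup>+x. \<integral>\<^sup>+y. indicator bad (merge ?I ?J (x, y)) \<partial>normal_product ?J \<partial>normal_product ?I)"
    unfolding M
  proof (rule normal_product.product_nn_integral_fold)
    show "indicator bad \<in> borel_measurable (normal_product (?I \<union> ?J))"
      using borel_measurable_indicator[OF bad] unfolding M .
  qed auto
  also have "\<dots> \<le> (\<integral>\<^sup>+x. ennreal (2 * p) \<partial>normal_product ?I)"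
  proof (rule nn_integral_mono)
    fix x assume "x \<in> space (normal_product ?I)"
    \<comment> \<open>The point \<open>x\<close> carries no draw number \<open>i\<close>. The
      entries it has there are irrelevant, since \<open>B i\<close> only reads the earlier
      draws.\<close>
    interpret pca_run A d l L \<epsilon> \<delta> "draw_vec d x"
      by (rule pca_run.intro) (use A ld L \<epsilon> \<delta> in \<open>auto simp: draw_vec_def\<close>)
    interpret B: psd_mat "B i" d by (rule psd_B)
    let ?T = "{y \<in> space (normal_product ?J). \<not> good_draw k p (B i) (vec d (\<lambda>j. y (i, j)))}"
    have "Measurable.pred (normal_product ?J) (\<lambda>y. good_draw k p (B i) (vec d (\<lambda>j. y (i, j))))"
      by (intro good_draw_measurable[where d = d] mat_measurable_const B.carrier coordinates_measurable) auto
    then have "Measurable.pred (normal_product ?J) (\<lambda>y. \<not> good_draw k p (B i) (vec d (\<lambda>j. y (i, j))))"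
      by (rule pred_intros_logic)
    then have T: "?T \<in> sets (normal_product ?J)" unfolding Measurable.pred_def .
    have "indicator bad (merge ?I ?J (x, y)) \<le> (indicator ?T y :: ennreal)"
      if y: "y \<in> space (normal_product ?J)" for y
    proof -
      have "draw_vec d (merge ?I ?J (x, y)) i = vec d (\<lambda>j. y (i, j))"
        unfolding draw_vec_def by (intro eq_vecI) (auto simp: merge_def)
      moreover have "draw_vec d (merge ?I ?J (x, y)) j = draw_vec d x j" if "j < i" for j
        unfolding draw_vec_def using that i by (intro eq_vecI) (auto simp: merge_def)
      then have "pca_mat L A l \<epsilon> \<delta> (draw_vec d (merge ?I ?J (x, y))) i = B i"
        by (rule pca_mat_cong)
      ultimately show ?thesis using y by (auto simp: bad_def indicator_def)
    qed
    then have "(\<integral>\<^sup>+y. indicator bad (merge ?I ?J (x, y)) \<partial>normal_product ?J)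
        \<le> (\<integral>\<^sup>+y. indicator ?T y \<partial>normal_product ?J)"
      by (rule nn_integral_mono)
    also have "\<dots> = emeasure (normal_product ?J) ?T" by (rule nn_integral_indicator[OF T])
    also have "\<dots> \<le> ennreal (2 * p)"
      using ld p by (intro B.bad_draw_prob T) auto
    finally show "(\<integral>\<^sup>+y. indicator bad (merge ?I ?J (x, y)) \<partial>normal_product ?J) \<le> ennreal (2 * p)" .
  qed
  also have "\<dots> = ennreal (2 * p)" using I.emeasure_space_1 by simp
  finally show "emeasure M bad \<le> ennreal (2 * p)" .
qed

text \<open>Union bound over the \<open>l\<close> steps: each fails with probability at most
  \<open>2 * (\<delta> / (2 * real l))\<close>, which sums to \<open>\<delta>\<close>. Off the bad
  events the deterministic bounds for a run apply.\<close>

lemma pca_approx_prob: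
  fixes d l :: nat
  assumes A: "psd_mat A d" and ld: "1 \<le> l" "l \<le> d" and L: "12 \<le> L"
    and \<epsilon>: "0 < \<epsilon>" "\<epsilon> \<le> 1" and \<delta>: "0 < \<delta>" "\<delta> \<le> 1"
  shows "1 - \<delta> \<le> \<P>(\<omega> in gaussian_draws l d.
    (let A' = pca_approx A l (pca_vec L A l \<epsilon> \<delta> (draw_vec d \<omega>))
     in (1 - \<epsilon>) ^ l \<cdot>\<^sub>m A' \<preceq>\<^sub>L A \<and> A \<preceq>\<^sub>L (1 + \<epsilon>) ^ l \<cdot>\<^sub>m A'))"
proof -
  let ?M = "gaussian_draws l d"
  let ?p = "\<delta> / (2 * real l)"
  let ?k = "2 * power_method_iters L d (\<epsilon> / (2 * real l)) ?p + 1"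
  let ?A' = "\<lambda>\<omega>. pca_approx A l (pca_vec L A l \<epsilon> \<delta> (draw_vec d \<omega>))"
  define E where "E = {\<omega> \<in> space ?M. (1 - \<epsilon>) ^ l \<cdot>\<^sub>m ?A' \<omega> \<preceq>\<^sub>L A \<and> A \<preceq>\<^sub>L (1 + \<epsilon>) ^ l \<cdot>\<^sub>m ?A' \<omega>}"
  define bad where "bad i = {\<omega> \<in> space ?M.
    \<not> good_draw ?k ?p (pca_mat L A l \<epsilon> \<delta> (draw_vec d \<omega>) i) (draw_vec d \<omega> i)}" for i
  interpret prob_space ?M
    unfolding gaussian_draws_def by (rule prob_space_normal_product)
  have A_carrier: "A \<in> carrier_mat d d" using A by (rule psd_mat.carrier)
  have A': "mat_measurable d ?M ?A'"
    by (intro pca_approx_measurable pca_vec_measurable A_carrier draw_vec_measurable) simp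
  have "Measurable.pred ?M (\<lambda>\<omega>. (1 - \<epsilon>) ^ l \<cdot>\<^sub>m ?A' \<omega> \<preceq>\<^sub>L A \<and> A \<preceq>\<^sub>L (1 + \<epsilon>) ^ l \<cdot>\<^sub>m ?A' \<omega>)"
    by (intro pred_intros_logic loewner_le_measurable[where d = d] mat_measurable_smult A'
        borel_measurable_const mat_measurable_const A_carrier)
  then have E: "E \<in> events" unfolding E_def Measurable.pred_def .
  have p: "0 \<le> ?p" using \<delta> by simp
  have bad_events: "bad i \<in> events" if "i \<in> {..<l}" for i
    unfolding bad_def using that by (intro bad_step_prob(1)[OF A _ ld L \<epsilon> \<delta> p]) simp
  have bad_prob: "prob (bad i) \<le> 2 * ?p" if "i \<in> {..<l}" for i
  proof -
    have "emeasure ?M (bad i) \<le> ennreal (2 * ?p)"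
      unfolding bad_def using that by (intro bad_step_prob(2)[OF A _ ld L \<epsilon> \<delta> p]) simp
    then show ?thesis using p by (simp add: emeasure_eq_measure)
  qed
  have U: "(\<Union>i\<in>{..<l}. bad i) \<in> events" using bad_events by blast
  have "prob (\<Union>i\<in>{..<l}. bad i) \<le> (\<Sum>i\<in>{..<l}. prob (bad i))"
    using bad_events by (intro finite_measure_subadditive_finite) auto
  also have "\<dots> \<le> (\<Sum>i\<in>{..<l}. 2 * ?p)" using bad_prob by (rule sum_mono)
  also have "\<dots> = \<delta>" using ld by simp
  finally have "1 - \<delta> \<le> prob (space ?M - (\<Union>i\<in>{..<l}. bad i))"
    using prob_compl[OF U] by simp
  also have "\<dots> \<le> prob E"
  proof (rule finite_measure_mono[OF _ E], rule subsetI)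
    fix \<omega> assume \<omega>: "\<omega> \<in> space ?M - (\<Union>i\<in>{..<l}. bad i)"
    interpret pca_run A d l L \<epsilon> \<delta> "draw_vec d \<omega>"
      by (rule pca_run.intro) (use A ld L \<epsilon> \<delta> in \<open>auto simp: draw_vec_def\<close>)
    have "good_draw (2 * t + 1) p (B i) (draw_vec d \<omega> i)" if "i < l" for i
      using \<omega> that unfolding bad_def t_def e_def p_def by blast
    then show "\<omega> \<in> E" using loewner_bounds \<omega> unfolding E_def by blast
  qed
  finally show ?thesis unfolding E_def Let_def .
qed

theorem theorem6p1:
  shows "\<exists>(L0::real) > 0. \<exists>(C::real) > 0. \<forall>L \<ge> L0.
    \<forall>(d::nat) (A::real mat) (l::nat) (\<epsilon>::real) (\<delta>::real).
      A \<in> carrier_mat d d \<longrightarrow> positive_semidefinite A \<longrightarrow>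
      1 \<le> l \<longrightarrow> l \<le> d \<longrightarrow> 0 < \<epsilon> \<longrightarrow> \<epsilon> \<le> 1 \<longrightarrow> 0 < \<delta> \<longrightarrow>
      \<P>(\<omega> in gaussian_draws l d.
          (let A' = pca_approx A l (pca_vec L A l \<epsilon> \<delta> (draw_vec d \<omega>))
           in (1 - \<epsilon>) ^ l \<cdot>\<^sub>m A' \<preceq>\<^sub>L A \<and> A \<preceq>\<^sub>L (1 + \<epsilon>) ^ l \<cdot>\<^sub>m A'))
        \<ge> 1 - C * (real l * \<delta>)"
proof (intro exI conjI allI impI)
  \<comment> \<open>The witness 12 is the threshold on \<open>L\<close> from the iteration count.
    The witness 1 works because the failure probability \<open>\<delta>\<close> is at most
    \<open>real l * \<delta>\<close>.\<close>
  show "0 < (12 :: real)" "0 < (1 :: real)" by simp_all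
  fix L :: real and d :: nat and A :: "real mat" and l :: nat and \<epsilon> \<delta> :: real
  assume L: "12 \<le> L" and A: "A \<in> carrier_mat d d" "positive_semidefinite A"
    and ld: "1 \<le> l" "l \<le> d" and \<epsilon>: "0 < \<epsilon>" "\<epsilon> \<le> 1" and \<delta>: "0 < \<delta>"
  have le: "\<delta> \<le> real l * \<delta>" using ld \<delta> by simp
  show "1 - 1 * (real l * \<delta>) \<le> \<P>(\<omega> in gaussian_draws l d.
    (let A' = pca_approx A l (pca_vec L A l \<epsilon> \<delta> (draw_vec d \<omega>))
     in (1 - \<epsilon>) ^ l \<cdot>\<^sub>m A' \<preceq>\<^sub>L A \<and> A \<preceq>\<^sub>L (1 + \<epsilon>) ^ l \<cdot>\<^sub>m A'))" (is "_ \<le> ?P")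
  proof (cases "\<delta> \<le> 1")
    case True
    have "1 - \<delta> \<le> ?P"
      using psd_mat.intro[OF A] ld L \<epsilon> \<delta> True by (rule pca_approx_prob)
    then show ?thesis using le by linarith
  next
    case False
    \<comment> \<open>For \<open>\<delta> > 1\<close> the claimed lower bound is negative.\<close>
    have "0 \<le> ?P" by (rule measure_nonneg)
    then show ?thesis using False le by linarith
  qed
qed

end
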